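(* Let $N\geq 1$ be an integer and let $\Omega$ be a nonempty compact subset of $\mathbb{P}^N(\mathbb{R})$ which supports a measure $m$ that is $\delta$-Ahlfors regular and projectively absolutely $\eta$-decaying, for some $\delta,\eta>0$. Then $$\dim_{\mathrm{H}}\big(\mathbf{Bad}_{\mathbb{P}}^{\infty}(N)\cap\Omega\big)=\dim_{\mathrm{H}}(\Omega)=\delta.$$
   Context: Let $\phi:\mathbb{R}^{N+1}\setminus\{\mathbf{0}\}\to\mathbb{P}^N(\mathbb{R})$ be the quotient map sending $\mathbf{x}=(x_0,\ldots,x_N)$ to the point $\hat{\mathbf{x}}$ with homogeneous coordinates $[x_0,\ldots,x_N]$. The space $\mathbb{P}^N(\mathbb{R})$ carries the metric $$\delta_\infty(\hat{\mathbf{x}},\hat{\mathbf{y}})=\frac{|\mathbf{x}\wedge\mathbf{y}|}{|\mathbf{x}|\,|\mathbf{y}|},\qquad \hat{\mathbf{x}}=\phi(\mathbf{x}),\ \hat{\mathbf{y}}=\phi(\mathbf{y}),$$ where $|\cdot|$ is the Euclidean norm and $\wedge$ is the exterior product; equivalently, $\delta_\infty(\hat{\mathbf{x}},\hat{\mathbf{y}})$ is the sine of the smallest angle between the lines spanned by $\mathbf{x}$ and $\mathbf{y}$, so $|\mathbf{x}\wedge\mathbf{y}|^2=|\mathbf{x}|^2|\mathbf{y}|^2-(\mathbf{x}\cdot\mathbf{y})^2$. Hausdorff dimension $\dim_{\mathrm{H}}$ is taken with respect to $\delta_\infty$. $\mathbb{P}^N(\mathbb{Q})\subset\mathbb{P}^N(\mathbb{R})$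 denotes the set of points having a representative in $\mathbb{Q}^{N+1}\setminus\{\mathbf{0}\}$. The height of $\hat{\mathbf{q}}\in\mathbb{P}^N(\mathbb{Q})$ is $H(\hat{\mathbf{q}})=\max(|q'_1|,\ldots,|q'_{N+1}|)$, where $(q'_1,\ldots,q'_{N+1})$ is a representative of $\hat{\mathbf{q}}$ consisting of integers, not all zero, with $\gcd(q'_1,\ldots,q'_{N+1})=1$. The set of badly approximable points is $$\mathbf{Bad}_{\mathbb{P}}^{\infty}(N)=\Big\{\hat{\mathbf{x}}\in\mathbb{P}^N(\mathbb{R}):\ \inf_{\hat{\mathbf{q}}\in\mathbb{P}^N(\mathbb{Q})}H(\hat{\mathbf{q}})^{\frac{N+1}{N}}\,\delta_\infty(\hat{\mathbf{x}},\hat{\mathbf{q}})>0\Big\}.$$ Measure conditions. All measures considered are locally finite Borel measures supported on the compact set $\Omega\subseteq\mathbb{P}^N(\mathbb{R})$. Write $\hat{B}(\hat{\mathbf{x}},r)$ for the closed ball in $(\mathbb{P}^N(\mathbb{R}),\delta_\infty)$ with centre $\hat{\mathbf{x}}\in\Omega$ and radius $r>0$; only radii $r\le\sin 1$ are considered. (i) A measure $m$ is $\delta$-Ahlfors regular ($\delta>0$) if there exist $r_0>0$ and constants $0<a\le 1\le b$ such that $a r^{\delta}\le m(\hat{B}(\hat{\mathbf{x}},r))\le b r^{\delta}$ for all $\hat{\mathbf{x}}\in\Omega$ and all $0<r<r_0$. (ii) A projective hyperplane is a set $\mathcal{P}=\phi(\mathcal{L}\setminus\{\mathbf{0}\})$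 where $\mathcal{L}$ is an $N$-dimensional linear subspace of $\mathbb{R}^{N+1}$. For $\epsilon>0$ put $\mathcal{P}^{(\epsilon)}=\{\hat{\mathbf{x}}\in\mathbb{P}^N(\mathbb{R}):\inf_{\hat{\mathbf{y}}\in\mathcal{P}}\delta_\infty(\hat{\mathbf{x}},\hat{\mathbf{y}})<\epsilon\}$. A measure $m$ is projectively absolutely $\eta$-decaying ($\eta>0$) if there exist constants $c>0$ and $r_0>0$ such that for every projective hyperplane $\mathcal{P}$, every $\epsilon>0$, every $\hat{\mathbf{x}}\in\Omega$ and every $0<r<r_0$, $$m\big(\hat{B}(\hat{\mathbf{x}},r)\cap\mathcal{P}^{(\epsilon)}\big)\le c\left(\frac{\epsilon}{r}\right)^{\eta}m\big(\hat{B}(\hat{\mathbf{x}},r)\big).$$ *)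

theory Defs
  imports "HOL-Analysis.Analysis"
begin

section \<open>The exterior product of two vectors\<close>

definition wedge :: "real^'n \<Rightarrow> real^'n \<Rightarrow> real^'n^'n" where
  "wedge x y = (\<chi> i j. x $ i * y $ j - x $ j * y $ i)"

text \<open>The vectors $e_i \wedge e_j$ with $i < j$ are orthonormal. The Frobenius norm of the
  skew-symmetric coordinate matrix counts each pair twice, whence the factor $\sqrt 2$.\<close>

definition wedge_norm :: "real^'n \<Rightarrow> real^'n \<Rightarrow> real" where
  "wedge_norm x y = norm (wedge x y) / sqrt 2"

lemma norm_matrix_squared:
  fixes A :: "real^'n^'n"
  shows "(norm A)\<^sup>2 = (\<Sum>i\<in>UNIV. \<Sum>j\<in>UNIV. (A $ i $ j)\<^sup>2)"
  by (simp add: power2_norm_eq_inner inner_vec_def) (simp add: power2_eq_square)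

lemma double_sum_squares:
  fixes x y :: "real^'n"
  shows "(\<Sum>i\<in>UNIV. (x $ i)\<^sup>2 * (\<Sum>j\<in>UNIV. (y $ j)\<^sup>2)) = (norm x)\<^sup>2 * (norm y)\<^sup>2"
    and "(\<Sum>i\<in>UNIV. x $ i * y $ i * (\<Sum>j\<in>UNIV. x $ j * y $ j)) = (x \<bullet> y)\<^sup>2"
  unfolding sum_distrib_right[symmetric] by (simp_all add: power2_norm_eq_inner inner_vec_def)
    (simp_all add: power2_eq_square)

lemma wedge_norm_squared:
  "(wedge_norm x y)\<^sup>2 = (norm x)\<^sup>2 * (norm y)\<^sup>2 - (x \<bullet> y)\<^sup>2"
proof -
  have "(norm (wedge x y))\<^sup>2 =
      (\<Sum>i\<in>UNIV. \<Sum>j\<in>UNIV. (x$i)\<^sup>2 * (y$j)\<^sup>2 + (y$i)\<^sup>2 * (x$j)\<^sup>2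
        - 2 * ((x$i * y$i) * (x$j * y$j)))"
    unfolding norm_matrix_squared wedge_def
    by (intro sum.cong refl) (simp add: power2_eq_square algebra_simps)
  also have "\<dots> = 2 * ((norm x)\<^sup>2 * (norm y)\<^sup>2) - 2 * (x \<bullet> y)\<^sup>2"
    unfolding sum.distrib sum_subtractf sum_distrib_left[symmetric] double_sum_squares by simp
  finally show ?thesis
    by (simp add: wedge_norm_def power_divide)
qed

lemma wedge_norm_nonneg: "0 \<le> wedge_norm x y"
  by (simp add: wedge_norm_def)

lemma wedge_norm_eq: "wedge_norm x y = sqrt ((norm x)\<^sup>2 * (norm y)\<^sup>2 - (x \<bullet> y)\<^sup>2)"
  by (metis real_sqrt_unique wedge_norm_nonneg wedge_norm_squared)

lemma wedge_norm_scaleR: "wedge_norm (a *\<^sub>R x) (b *\<^sub>R y) = \<bar>a\<bar> * \<bar>b\<bar> * wedge_norm x y"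
proof -
  have "wedge (a *\<^sub>R x) (b *\<^sub>R y) = (a * b) *\<^sub>R wedge x y"
    by (simp add: wedge_def vec_eq_iff algebra_simps)
  then show ?thesis by (simp add: wedge_norm_def abs_mult)
qed

section \<open>Real projective space as a metric space\<close>

definition proj_rel :: "real^'n \<Rightarrow> real^'n \<Rightarrow> bool" where
  "proj_rel x y \<longleftrightarrow> x \<noteq> 0 \<and> y \<noteq> 0 \<and> (\<exists>c. c \<noteq> 0 \<and> y = c *\<^sub>R x)"

lemma part_equivp_proj_rel: "part_equivp (proj_rel :: real^'n \<Rightarrow> real^'n \<Rightarrow> bool)"
proof (rule part_equivpI)
  have "proj_rel (1 :: real^'n) 1"
    unfolding proj_rel_def by (auto intro: exI[of _ 1])
  then show "\<exists>x :: real^'n. proj_rel x x" ..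
  show "symp (proj_rel :: real^'n \<Rightarrow> real^'n \<Rightarrow> bool)"
  proof (rule sympI)
    fix x y :: "real^'n" assume "proj_rel x y"
    then obtain c where "x \<noteq> 0" "y \<noteq> 0" "c \<noteq> 0" "y = c *\<^sub>R x" by (auto simp: proj_rel_def)
    then show "proj_rel y x" unfolding proj_rel_def by (auto intro!: exI[of _ "inverse c"])
  qed
  show "transp (proj_rel :: real^'n \<Rightarrow> real^'n \<Rightarrow> bool)"
  proof (rule transpI)
    fix x y z :: "real^'n" assume "proj_rel x y" "proj_rel y z"
    then show "proj_rel x z" unfolding proj_rel_def
      by (metis mult_eq_0_iff scaleR_scaleR)
  qed
qed

text \<open>Here \<open>'n\<close> indexes the homogeneous coordinates, so \<open>'n proj\<close> has dimension
  \<open>CARD('n) - 1\<close>. The quotient map \<open>proj_pt\<close> is meaningful on nonzero vectors only.\<close>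

quotient_type (overloaded) 'n proj = "real^('n::finite)" / partial: proj_rel
  morphisms rep_proj proj_pt
  by (rule part_equivp_proj_rel)

lemma proj_pt_cases:
  obtains x where "x \<noteq> 0" "p = proj_pt x"
proof -
  have "proj_rel (rep_proj p) (rep_proj p)"
    by (rule Quotient_rep_reflp[OF Quotient_proj])
  moreover have "p = proj_pt (rep_proj p)"
    by (rule Quotient_abs_rep[OF Quotient_proj, symmetric])
  ultimately show ?thesis using that unfolding proj_rel_def by blast
qed

lemma proj_pt_eq_iff:
  assumes "x \<noteq> 0" "y \<noteq> 0"
  shows "proj_pt x = proj_pt y \<longleftrightarrow> (\<exists>c. c \<noteq> 0 \<and> y = c *\<^sub>R x)"
proof -
  have refl: "proj_rel z z" if "z \<noteq> 0" for z :: "real^'n"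
    using that unfolding proj_rel_def by (auto intro: exI[of _ 1])
  have "proj_rel x y \<longleftrightarrow> proj_pt x = proj_pt y"
    using Quotient_rel[OF Quotient_proj, of x y] refl[OF assms(1)] refl[OF assms(2)] by blast
  then show ?thesis using assms by (simp add: proj_rel_def)
qed

text \<open>On unit vectors the distance below is a multiple of the Frobenius distance between
  orthogonal projections; this yields the triangle inequality.\<close>

lemma norm_outer_diff:
  fixes x y :: "real^'n"
  assumes "norm x = 1" "norm y = 1"
  shows "norm ((\<chi> i j. x $ i * x $ j) - (\<chi> i j. y $ i * y $ j) :: real^'n^'n) / sqrt 2
    = wedge_norm x y"
proof -
  let ?A = "(\<chi> i j. x $ i * x $ j) - (\<chi> i j. y $ i * y $ j) :: real^'n^'n"
  have "(norm ?A)\<^sup>2 =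
      (\<Sum>i\<in>UNIV. \<Sum>j\<in>UNIV. (x$i)\<^sup>2 * (x$j)\<^sup>2 + (y$i)\<^sup>2 * (y$j)\<^sup>2
        - 2 * ((x$i * y$i) * (x$j * y$j)))"
    unfolding norm_matrix_squared
    by (intro sum.cong refl) (simp add: power2_eq_square algebra_simps)
  also have "\<dots> = 2 - 2 * (x \<bullet> y)\<^sup>2"
    unfolding sum.distrib sum_subtractf sum_distrib_left[symmetric] double_sum_squares
    using assms by simp
  finally have "(norm ?A / sqrt 2)\<^sup>2 = (wedge_norm x y)\<^sup>2"
    using assms by (simp add: power_divide wedge_norm_squared)
  then show ?thesis
    by (simp add: wedge_norm_nonneg power2_eq_iff_nonneg)
qed

lemma wedge_norm_sgn: "wedge_norm x y / (norm x * norm y) = wedge_norm (sgn x) (sgn y)"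
  by (simp add: sgn_div_norm wedge_norm_scaleR divide_inverse mult.commute)

lemma wedge_norm_quotient_triangle:
  fixes x y z :: "real^'n"
  assumes "x \<noteq> 0" "y \<noteq> 0" "z \<noteq> 0"
  shows "wedge_norm x y / (norm x * norm y) \<le>
    wedge_norm x z / (norm x * norm z) + wedge_norm y z / (norm y * norm z)"
proof -
  have u: "norm (sgn x) = 1" "norm (sgn y) = 1" "norm (sgn z) = 1"
    using assms by (simp_all add: norm_sgn)
  define P :: "real^'n \<Rightarrow> real^'n^'n" where "P v = (\<chi> i j. v $ i * v $ j)" for v
  have "norm (P (sgn x) - P (sgn y)) \<le>
      norm (P (sgn x) - P (sgn z)) + norm (P (sgn y) - P (sgn z))"
    using norm_triangle_ineq4[of "P (sgn x) - P (sgn z)" "P (sgn y) - P (sgn z)"] by simp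
  then have "norm (P (sgn x) - P (sgn y)) / sqrt 2 \<le>
      norm (P (sgn x) - P (sgn z)) / sqrt 2 + norm (P (sgn y) - P (sgn z)) / sqrt 2"
    by (simp add: divide_right_mono flip: add_divide_distrib)
  then show ?thesis
    unfolding wedge_norm_sgn P_def norm_outer_diff[OF u(1,2)]
      norm_outer_diff[OF u(1,3)] norm_outer_diff[OF u(2,3)] .
qed

lemma wedge_norm_eq_0_iff:
  fixes x y :: "real^'n"
  assumes "x \<noteq> 0" "y \<noteq> 0"
  shows "wedge_norm x y = 0 \<longleftrightarrow> (\<exists>c. c \<noteq> 0 \<and> y = c *\<^sub>R x)"
proof
  assume "wedge_norm x y = 0"
  then have w: "x $ i * y $ j = x $ j * y $ i" for i j
    by (simp add: wedge_norm_def wedge_def vec_eq_iff)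
  obtain k where k: "x $ k \<noteq> 0" using assms(1) by (auto simp: vec_eq_iff)
  have "y = (y $ k / x $ k) *\<^sub>R x"
    using k w[of k] by (simp add: vec_eq_iff field_simps)
  with assms(2) show "\<exists>c. c \<noteq> 0 \<and> y = c *\<^sub>R x" by (metis scaleR_zero_left)
next
  assume "\<exists>c. c \<noteq> 0 \<and> y = c *\<^sub>R x"
  then show "wedge_norm x y = 0" by (auto simp: wedge_norm_def wedge_def vec_eq_iff)
qed

instantiation proj :: (finite) metric_space
begin

lift_definition dist_proj :: "'a proj \<Rightarrow> 'a proj \<Rightarrow> real" is
  "\<lambda>x y. wedge_norm x y / (norm x * norm y)"
  by (auto simp: proj_rel_def wedge_norm_scaleR)

definition uniformity_proj :: "('a proj \<times> 'a proj) filter" where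
  "uniformity_proj = (INF e\<in>{0<..}. principal {(p, q). dist p q < e})"

definition open_proj :: "'a proj set \<Rightarrow> bool" where
  "open_proj U \<longleftrightarrow> (\<forall>p\<in>U. eventually (\<lambda>(p', q). p' = p \<longrightarrow> q \<in> U) uniformity)"

lemma dist_proj_pt:
  fixes x y :: "real^'a"
  assumes "x \<noteq> 0" "y \<noteq> 0"
  shows "dist (proj_pt x) (proj_pt y) = wedge_norm x y / (norm x * norm y)"
proof -
  have "proj_rel z z" if "z \<noteq> 0" for z :: "real^'a"
    using that unfolding proj_rel_def by (auto intro: exI[of _ 1])
  then show ?thesis using dist_proj.abs_eq[of x y] assms by blast
qed

instance
proof
  fix p q r :: "'a proj"
  obtain x where x: "x \<noteq> 0" "p = proj_pt x" by (rule proj_pt_cases)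
  obtain y where y: "y \<noteq> 0" "q = proj_pt y" by (rule proj_pt_cases)
  obtain z where z: "z \<noteq> 0" "r = proj_pt z" by (rule proj_pt_cases)
  show "dist p q = 0 \<longleftrightarrow> p = q"
    using x y by (simp add: dist_proj_pt proj_pt_eq_iff wedge_norm_eq_0_iff)
  show "dist p q \<le> dist p r + dist q r"
    using x y z by (simp add: dist_proj_pt wedge_norm_quotient_triangle)
qed (simp_all add: uniformity_proj_def open_proj_def)

end

section \<open>Rational points, heights, and badly approximable points\<close>

definition rational_points :: "'n::finite proj set" where
  "rational_points = {proj_pt x | x. x \<noteq> 0 \<and> (\<forall>i. x $ i \<in> \<rat>)}"

definition primitive_vec :: "int^'n \<Rightarrow> bool" where
  "primitive_vec z \<longleftrightarrow> z \<noteq> 0 \<and> Gcd (range (($) z)) = 1"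

definition real_vec :: "int^'n \<Rightarrow> real^'n" where
  "real_vec z = (\<chi> i. of_int (z $ i))"

definition height :: "'n::finite proj \<Rightarrow> int" where
  "height q = (THE h. \<exists>z. primitive_vec z \<and> q = proj_pt (real_vec z) \<and>
    h = Max (range (\<lambda>i. \<bar>z $ i\<bar>)))"

lemma real_vec_eq_0_iff: "real_vec z = 0 \<longleftrightarrow> z = 0"
  by (simp add: real_vec_def vec_eq_iff)

lemma primitive_vec_unique:
  assumes z: "primitive_vec z" and w: "primitive_vec w"
    and eq: "proj_pt (real_vec z) = proj_pt (real_vec w)"
  shows "\<bar>z $ i\<bar> = \<bar>w $ i\<bar>"
proof -
  have nz: "real_vec z \<noteq> 0" "real_vec w \<noteq> 0"
    using z w by (simp_all add: real_vec_eq_0_iff primitive_vec_def)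
  obtain c where c: "real_vec w = c *\<^sub>R real_vec z"
    using eq proj_pt_eq_iff[OF nz] by blast
  have "of_int (w $ l) = c * of_int (z $ l)" for l
    using c by (simp add: real_vec_def vec_eq_iff)
  then have "(of_int (z $ j * w $ k) :: real) = of_int (z $ k * w $ j)" for j k by simp
  then have cross: "z $ j * w $ k = z $ k * w $ j" for j k
    unfolding of_int_eq_iff .
  have dvd: "b $ i dvd a $ i" if ab: "\<And>k. a $ i * b $ k = a $ k * b $ i" and b: "primitive_vec b"
    for a b :: "int^'a"
  proof -
    have "b $ i dvd Gcd ((*) (a $ i) ` range (($) b))"
      by (rule Gcd_greatest) (auto simp: ab)
    then show ?thesis using b by (simp add: Gcd_mult primitive_vec_def)
  qed
  have "w $ i dvd z $ i" by (rule dvd[OF cross w])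
  moreover have "z $ i dvd w $ i"
    by (rule dvd[OF _ z]) (metis cross mult.commute)
  ultimately show ?thesis by (metis zdvd_antisym_abs)
qed

lemma height_proj_pt:
  assumes "primitive_vec z"
  shows "height (proj_pt (real_vec z)) = Max (range (\<lambda>i. \<bar>z $ i\<bar>))"
  unfolding height_def
proof (rule the_equality)
  fix h
  assume "\<exists>w. primitive_vec w \<and> proj_pt (real_vec z) = proj_pt (real_vec w) \<and> h = Max (range (\<lambda>i. \<bar>w $ i\<bar>))"
  then show "h = Max (range (\<lambda>i. \<bar>z $ i\<bar>))"
    using primitive_vec_unique[OF assms] by auto
qed (use assms in blast)

lemma rational_points_primitive:
  assumes "q \<in> rational_points"
  obtains z where "primitive_vec z" "q = proj_pt (real_vec z)"
proof -
  obtain x where x: "x \<noteq> 0" "\<And>i. x $ i \<in> \<rat>" "q = proj_pt x"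
    using assms by (auto simp: rational_points_def)
  have "\<exists>n d :: int. d \<noteq> 0 \<and> x $ i = of_int n / of_int d" for i
    using x(2)[of i] by (elim Rats_cases') (metis less_irrefl)
  then obtain n d :: "'a \<Rightarrow> int" where nd: "\<And>i. d i \<noteq> 0" "\<And>i. x $ i = of_int (n i) / of_int (d i)"
    by metis
  define D where "D = (\<Prod>i\<in>UNIV. d i)"
  have D: "D \<noteq> 0" using nd by (simp add: D_def)
  have "\<exists>v. of_int D * x $ i = of_int v" for i
  proof -
    have "D = d i * (\<Prod>j\<in>UNIV - {i}. d j)" unfolding D_def by (simp add: prod.remove)
    then have "of_int D * x $ i = of_int (n i * (\<Prod>j\<in>UNIV - {i}. d j))"
      using nd(1)[of i] by (simp add: nd(2)[of i])
    then show ?thesis by blast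
  qed
  then obtain v where v: "\<And>i. of_int D * x $ i = of_int (v i)" by metis
  define g where "g = Gcd (range v)"
  obtain k where k: "x $ k \<noteq> 0" using x(1) by (auto simp: vec_eq_iff)
  have vk: "v k \<noteq> 0" using k D v[of k] by auto
  have g: "g \<noteq> 0" using vk by (auto simp: g_def)
  have gd: "g dvd v i" for i by (simp add: g_def)
  define z :: "int^'a" where "z = (\<chi> i. v i div g)"
  have gz: "g * z $ i = v i" for i using gd[of i] by (simp add: z_def)
  have "range v = (*) g ` range (($) z)" by (auto simp: gz image_image)
  then have "g = \<bar>g * Gcd (range (($) z))\<bar>"
    using Gcd_mult[of g "range (($) z)"] by (simp add: g_def del: Gcd_mult)
  moreover have "0 \<le> g" "0 \<le> Gcd (range (($) z))" by (simp_all add: g_def)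
  ultimately have "g = g * Gcd (range (($) z))" by simp
  then have "Gcd (range (($) z)) = 1" using g by simp
  moreover have z0: "z \<noteq> 0" using gz[of k] vk by auto
  ultimately have "primitive_vec z" by (simp add: primitive_vec_def)
  moreover have "q = proj_pt (real_vec z)"
  proof -
    have "of_int D * x $ i = of_int g * of_int (z $ i)" for i
      unfolding v gz[symmetric] by simp
    then have "real_vec z = (of_int D / of_int g) *\<^sub>R x"
      using g by (simp add: vec_eq_iff real_vec_def field_simps)
    moreover have "(of_int D / of_int g :: real) \<noteq> 0" using D g by simp
    ultimately show ?thesis
      unfolding x(3) using proj_pt_eq_iff[of x "real_vec z"] x(1) z0 real_vec_eq_0_iff[of z] by blast
  qed
  ultimately show ?thesis by (rule that)
qed

definition Bad :: "nat \<Rightarrow> 'n::finite proj set" where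
  "Bad N = {p. (INF q\<in>rational_points.
    real_of_int (height q) powr (real (N + 1) / real N) * dist p q) > 0}"

section \<open>Hausdorff dimension\<close>

definition hausdorff_pre :: "real \<Rightarrow> real \<Rightarrow> 'a::metric_space set \<Rightarrow> ennreal" where
  "hausdorff_pre s \<epsilon> A =
    (INF U\<in>{U :: nat \<Rightarrow> 'a set. A \<subseteq> (\<Union>i. U i) \<and> (\<forall>i. bounded (U i) \<and> diameter (U i) \<le> \<epsilon>)}.
      \<Sum>i. ennreal (diameter (U i) powr s))"

definition hausdorff_measure :: "real \<Rightarrow> 'a::metric_space set \<Rightarrow> ennreal" where
  "hausdorff_measure s A = (SUP \<epsilon>\<in>{0<..}. hausdorff_pre s \<epsilon> A)"

text \<open>Restricting to \<open>s > 0\<close> avoids the convention \<open>0 powr 0 = 0\<close>; it does not change the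
  infimum, which is \<open>\<infinity>\<close> if no such \<open>s\<close> exists.\<close>

definition hausdorff_dim :: "'a::metric_space set \<Rightarrow> ennreal" where
  "hausdorff_dim A = Inf {ennreal s | s. s > 0 \<and> hausdorff_measure s A = 0}"

section \<open>Conditions on measures\<close>

definition locally_finite_borel :: "'a::topological_space measure \<Rightarrow> bool" where
  "locally_finite_borel m \<longleftrightarrow>
    sets m = sets borel \<and> (\<forall>x. \<exists>U. open U \<and> x \<in> U \<and> emeasure m U < \<infinity>)"

definition supported_on :: "'a::topological_space measure \<Rightarrow> 'a set \<Rightarrow> bool" where
  "supported_on m \<Omega> \<longleftrightarrow> emeasure m (- \<Omega>) = 0"

definition ahlfors_regular :: "real \<Rightarrow> 'a::metric_space set \<Rightarrow> 'a measure \<Rightarrow> bool" where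
  "ahlfors_regular \<delta> \<Omega> m \<longleftrightarrow>
    (\<exists>r0 a b. r0 > 0 \<and> 0 < a \<and> a \<le> 1 \<and> 1 \<le> b \<and>
      (\<forall>x\<in>\<Omega>. \<forall>r. 0 < r \<and> r < r0 \<and> r \<le> sin 1 \<longrightarrow>
        ennreal (a * r powr \<delta>) \<le> emeasure m (cball x r) \<and>
        emeasure m (cball x r) \<le> ennreal (b * r powr \<delta>)))"

definition proj_hyperplane :: "nat \<Rightarrow> 'n::finite proj set \<Rightarrow> bool" where
  "proj_hyperplane N P \<longleftrightarrow> (\<exists>L. subspace L \<and> dim L = N \<and> P = proj_pt ` (L - {0}))"

definition thickening :: "'a::metric_space set \<Rightarrow> real \<Rightarrow> 'a set" where
  "thickening P \<epsilon> = {x. (INF y\<in>P. dist x y) < \<epsilon>}"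

definition proj_abs_decaying :: "nat \<Rightarrow> real \<Rightarrow> 'n::finite proj set \<Rightarrow> 'n proj measure \<Rightarrow> bool" where
  "proj_abs_decaying N \<eta> \<Omega> m \<longleftrightarrow>
    (\<exists>c r0. c > 0 \<and> r0 > 0 \<and>
      (\<forall>P \<epsilon>. proj_hyperplane N P \<and> \<epsilon> > 0 \<longrightarrow>
        (\<forall>x\<in>\<Omega>. \<forall>r. 0 < r \<and> r < r0 \<and> r \<le> sin 1 \<longrightarrow>
          emeasure m (cball x r \<inter> thickening P \<epsilon>)
            \<le> ennreal (c * (\<epsilon> / r) powr \<eta>) * emeasure m (cball x r))))"

end

theory Submission
  imports Defs
begin

text \<open>The lower bound uses no Cantor measure: the sets of a hypothetical efficient cover of
  $\mathbf{Bad} \cap \Omega$ are treated as obstacles on the same footing as the rational points.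
  Descend through balls of radii $\rho_k = r_0 R^{-k}$ centred on $\Omega$. By the simplex lemma
  (an integer determinant of absolute value less than $1$ vanishes), the rational points near a ball
  of radius $\rho_k$ with $H^{(N+1)/N} \rho_k \le c_0$ lie in one hyperplane; by decay, half of the
  measure stays away from it, so Ahlfors regularity yields a constant times $R^\delta$ well separated
  children avoiding it, at least $R^s$ of them when $s < \delta$ and $R$ is large. A covering set
  smaller than $\rho_{k+1}$ meets at most one child, so some child sees at most the fraction $R^{-s}$
  of the total $s$-weight of the covering sets meeting its parent. Iterating, one reaches a
  badly approximable point of $\Omega$ that no covering set contains.\<close>

section \<open>Separated sets, covers, and nonvanishing Hausdorff measure along a tree\<close>

text \<open>A separated subset of \<open>A\<close> of maximal cardinality works, since a point of
  \<open>A\<close> missed by its balls could be added. Cardinalities are bounded because each ball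
  of radius \<open>e/2\<close> in a finite cover of \<open>K\<close> holds at most one point of a
  separated set.\<close>

lemma finite_separated_cover:
  fixes K :: "'a::metric_space set"
  assumes "compact K" "A \<subseteq> K" "e > 0"
  obtains F where "finite F" "F \<subseteq> A" "\<And>x y. x \<in> F \<Longrightarrow> y \<in> F \<Longrightarrow> x \<noteq> y \<Longrightarrow> dist x y > e"
    "A \<subseteq> (\<Union>y\<in>F. cball y e)"
proof -
  obtain C where C: "finite C" "K \<subseteq> (\<Union>x\<in>C. ball x (e/2))"
    using assms(1,3) unfolding compact_eq_totally_bounded by (meson half_gt_zero)
  define sep where "sep F \<longleftrightarrow> F \<subseteq> A \<and> (\<forall>x\<in>F. \<forall>y\<in>F. x \<noteq> y \<longrightarrow> dist x y > e)" for F
  have bound: "card F \<le> card C" if "sep F" for F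
  proof -
    have "F \<subseteq> (\<Union>x\<in>C. ball x (e/2))" using that C(2) assms(2) by (auto simp: sep_def)
    then have "\<forall>x\<in>F. \<exists>c\<in>C. dist c x < e/2" unfolding subset_iff UN_iff mem_ball by blast
    then obtain g where g: "\<And>x. x \<in> F \<Longrightarrow> g x \<in> C \<and> dist (g x) x < e/2" by metis
    have "inj_on g F"
    proof (rule inj_onI, rule ccontr)
      fix x y assume xy: "x \<in> F" "y \<in> F" "g x = g y" "x \<noteq> y"
      then have "dist x y > e" using that by (auto simp: sep_def)
      moreover have "dist x y < e" using dist_triangle_half_r[of "g x" x e y] g xy by metis
      ultimately show False by simp
    qed
    then show ?thesis using g C(1) by (intro card_inj_on_le) auto
  qed
  define P where "P n \<longleftrightarrow> (\<exists>F. finite F \<and> sep F \<and> card F = n)" for n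
  have "P 0" unfolding P_def sep_def by (intro exI[of _ "{}"]) auto
  moreover have "\<And>n. P n \<Longrightarrow> n \<le> card C" using bound by (auto simp: P_def)
  ultimately obtain n where n: "P n" "\<And>k. P k \<Longrightarrow> k \<le> n"
    using GreatestI_nat[of P 0 "card C"] Greatest_le_nat[of P _ "card C"] by metis
  then obtain F where F: "finite F" "sep F" "card F = n" by (auto simp: P_def)
  have "A \<subseteq> (\<Union>y\<in>F. cball y e)"
  proof (rule ccontr)
    assume "\<not> ?thesis"
    then obtain x where x: "x \<in> A" "\<And>y. y \<in> F \<Longrightarrow> dist y x > e" unfolding subset_iff UN_iff mem_cball by (meson not_le)
    then have "x \<notin> F" using assms(3) by force
    moreover have "sep (insert x F)"
      using x F(2) by (auto simp: sep_def dist_commute)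
    ultimately have "P (Suc n)" using F unfolding P_def by (metis card_insert_disjoint finite.insertI)
    then show False using n(2) by fastforce
  qed
  then show ?thesis using that[of F] F by (auto simp: sep_def)
qed

text \<open>Scale 1 is fine enough: the smallness of the sum will itself force the diameters of the
  covering sets to be small.\<close>

lemma hausdorff_measure_eq_0_cover:
  fixes A :: "'a::metric_space set"
  assumes "hausdorff_measure s A = 0" "\<kappa> > 0"
  obtains U :: "nat \<Rightarrow> 'a set" where "A \<subseteq> (\<Union>i. U i)" "\<And>i. bounded (U i)"
    "summable (\<lambda>i. diameter (U i) powr s)" "(\<Sum>i. diameter (U i) powr s) < \<kappa>"
proof -
  have "hausdorff_pre s 1 A \<le> hausdorff_measure s A"
    unfolding hausdorff_measure_def by (rule SUP_upper) simp
  then have "hausdorff_pre s 1 A < ennreal \<kappa>" using assms by simp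
  then obtain U :: "nat \<Rightarrow> 'a set" where U: "A \<subseteq> (\<Union>i. U i)" "\<And>i. bounded (U i)"
    "(\<Sum>i. ennreal (diameter (U i) powr s)) < ennreal \<kappa>"
    unfolding hausdorff_pre_def INF_less_iff by auto
  have "(\<Sum>i. ennreal (diameter (U i) powr s)) \<noteq> top" using U(3) by auto
  then have sm: "summable (\<lambda>i. diameter (U i) powr s)" by (rule summable_suminf_not_top[rotated]) simp
  have "ennreal (\<Sum>i. diameter (U i) powr s) < ennreal \<kappa>"
    using U(3) by (subst (asm) suminf_ennreal2[OF _ sm]) simp_all
  then have "(\<Sum>i. diameter (U i) powr s) < \<kappa>" by (subst (asm) ennreal_less_iff) (simp_all add: suminf_nonneg[OF sm])
  then show ?thesis using that[OF U(1,2) sm] by blast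
qed

text \<open>\<open>G\<close> collects what a step from a ball to its child guarantees; the last
  hypothesis turns the guarantees along a branch into membership of its limit in \<open>E\<close>.
  Centres more than three child radii apart keep a set of diameter at most one child radius from
  meeting two children.\<close>

lemma tree_hausdorff_measure_nonzero:
  fixes K E :: "'a::metric_space set"
  assumes K: "compact K" "K \<noteq> {}" and s: "s > 0" and R: "R > 1" and r0: "r0 > 0"
  assumes step: "\<And>k x. x \<in> K \<Longrightarrow> \<exists>F. finite F \<and> F \<subseteq> K \<and> real (card F) \<ge> R powr s \<and>
      (\<forall>y\<in>F. cball y (r0 / R ^ Suc k) \<subseteq> cball x (r0 / R ^ k) \<and> G k x y) \<and>
      (\<forall>y\<in>F. \<forall>y'\<in>F. y \<noteq> y' \<longrightarrow> dist y y' > 3 * (r0 / R ^ Suc k))"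
  assumes E: "\<And>X z. z \<in> K \<Longrightarrow> (\<And>k. X k \<in> K) \<Longrightarrow> (\<And>k. G k (X k) (X (Suc k))) \<Longrightarrow>
      (\<And>k. z \<in> cball (X k) (r0 / R ^ k)) \<Longrightarrow> z \<in> E"
  shows "hausdorff_measure s E \<noteq> 0"
proof
  define \<rho> where "\<rho> k = r0 / R ^ k" for k
  have \<rho>pos: "\<rho> k > 0" for k using R r0 by (simp add: \<rho>_def)
  have \<rho>Suc: "\<rho> (Suc k) * R = \<rho> k" for k using R by (simp add: \<rho>_def)
  have \<rho>0: "\<rho> \<longlonglongrightarrow> 0" unfolding \<rho>_def using R LIMSEQ_divide_realpow_zero by blast
  \<comment> \<open>The cover contributes less than \<open>\<kappa>\<close> and the geometric terms
    added below contribute \<open>2 * \<kappa>\<close>, so the total weight is less than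
    \<open>4 * \<kappa>\<close>, as the invariant demands at level 0.\<close>
  define \<kappa> where "\<kappa> = \<rho> 1 powr s / 4"
  have \<kappa>: "\<kappa> > 0" using \<rho>pos[of 1] by (simp add: \<kappa>_def)
  assume "hausdorff_measure s E = 0"
  then obtain U where U: "E \<subseteq> (\<Union>i. U i)" "\<And>i. bounded (U i)"
    "summable (\<lambda>i. diameter (U i) powr s)" "(\<Sum>i. diameter (U i) powr s) < \<kappa>"
    using hausdorff_measure_eq_0_cover[OF _ \<kappa>] by metis
  \<comment> \<open>The geometric term makes the weight of a one-point set positive.\<close>
  define w where "w i = diameter (U i) powr s + \<kappa> * (1/2) ^ i" for i
  have wpos: "w i > 0" for i using \<kappa> by (simp add: w_def add_nonneg_pos)
  have geo: "summable (\<lambda>i. \<kappa> * (1/2) ^ i)" by (intro summable_mult summable_geometric) simp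
  have w_eq: "w = (\<lambda>i. diameter (U i) powr s + \<kappa> * (1/2) ^ i)" by (simp add: w_def fun_eq_iff)
  have wsum: "summable w" unfolding w_eq by (rule summable_add[OF U(3) geo])
  have "suminf w = (\<Sum>i. diameter (U i) powr s) + (\<Sum>i. \<kappa> * (1/2) ^ i)"
    unfolding w_eq by (rule suminf_add[OF U(3) geo, symmetric])
  also have "(\<Sum>i. \<kappa> * (1/2) ^ i) = 2 * \<kappa>"
    using suminf_mult[of "\<lambda>i. (1/2::real) ^ i" \<kappa>] suminf_geometric[of "1/2::real"] by (simp add: summable_geometric)
  finally have wtot: "suminf w \<le> \<rho> 1 powr s" using U(4) \<kappa> unfolding \<kappa>_def by linarith
  define v where "v B i = (if U i \<inter> B \<noteq> {} then w i else 0)" for B i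
  have v: "0 \<le> v B i" "v B i \<le> w i" for B i using wpos[of i] by (auto simp: v_def)
  have vsum: "summable (v B)" for B
    by (rule summable_comparison_test[OF _ wsum]) (use v in auto)
  define W where "W B = suminf (v B)" for B
  have wW: "w i \<le> W B" if "U i \<inter> B \<noteq> {}" for i B
    using sum_le_suminf[OF vsum, of "{i}" B] v(1) that by (simp add: W_def v_def)
  \<comment> \<open>The bound uses the radius one level ahead: a covering set that meets the ball
    then has diameter at most the radius of the children.\<close>
  define Inv where "Inv k x \<longleftrightarrow> x \<in> K \<and> W (cball x (\<rho> k)) \<le> \<rho> (Suc k) powr s" for k x
  have "\<exists>x. Inv 0 x"
  proof -
    obtain x where x: "x \<in> K" using K by blast
    have "W (cball x (\<rho> 0)) \<le> suminf w" unfolding W_def by (intro suminf_le v vsum wsum)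
    then show ?thesis using x wtot unfolding Inv_def by auto
  qed
  moreover have "\<exists>y. Inv (Suc k) y \<and> cball y (\<rho> (Suc k)) \<subseteq> cball x (\<rho> k) \<and> G k x y" if inv: "Inv k x" for k x
  proof -
    have "\<exists>F. finite F \<and> F \<subseteq> K \<and> real (card F) \<ge> R powr s \<and>
      (\<forall>y\<in>F. cball y (\<rho> (Suc k)) \<subseteq> cball x (\<rho> k) \<and> G k x y) \<and>
      (\<forall>y\<in>F. \<forall>y'\<in>F. y \<noteq> y' \<longrightarrow> dist y y' > 3 * \<rho> (Suc k))"
      unfolding \<rho>_def by (rule step) (use inv in \<open>simp add: Inv_def\<close>)
    then obtain F where F: "finite F" "F \<subseteq> K" "real (card F) \<ge> R powr s"
      and FG: "\<forall>y\<in>F. cball y (\<rho> (Suc k)) \<subseteq> cball x (\<rho> k) \<and> G k x y"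
      and Fsep: "\<forall>y\<in>F. \<forall>y'\<in>F. y \<noteq> y' \<longrightarrow> dist y y' > 3 * \<rho> (Suc k)"
      by (elim exE conjE)
    have "card F > 0" using F(3) R powr_gt_zero[of R s] by linarith
    define V where "V y = v (cball y (\<rho> (Suc k)))" for y
    \<comment> \<open>The weight of each covering set is inherited by at most one child, and only if
      the set also meets the parent ball.\<close>
    have one: "(\<Sum>y\<in>F. V y i) \<le> v (cball x (\<rho> k)) i" for i
    proof (cases "\<exists>y\<in>F. U i \<inter> cball y (\<rho> (Suc k)) \<noteq> {}")
      case False
      then have "(\<Sum>y\<in>F. V y i) = 0" by (intro sum.neutral) (auto simp: v_def V_def)
      then show ?thesis using v by simp
    next
      case True
      then obtain y u where y: "y \<in> F" and u: "u \<in> U i" "u \<in> cball y (\<rho> (Suc k))" by blast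
      have meets: "U i \<inter> cball x (\<rho> k) \<noteq> {}" using u FG y by blast
      have "diameter (U i) powr s \<le> w i" using \<kappa> by (simp add: w_def)
      also have "\<dots> \<le> \<rho> (Suc k) powr s" using wW[OF meets] inv by (simp add: Inv_def)
      finally have d: "diameter (U i) \<le> \<rho> (Suc k)"
        using s \<rho>pos[of "Suc k"] by (smt (verit) powr_less_mono2)
      have "V y' i = 0" if y': "y' \<in> F - {y}" for y'
      proof (rule ccontr)
        assume "V y' i \<noteq> 0"
        then obtain u' where u': "u' \<in> U i" "u' \<in> cball y' (\<rho> (Suc k))"
          by (auto simp: V_def v_def split: if_splits)
        have "dist u u' \<le> \<rho> (Suc k)" using diameter_bounded_bound[OF U(2) u(1) u'(1)] d by simp
        moreover have "dist y y' \<le> dist y u + dist u u' + dist y' u'"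
          using dist_triangle[of y y' u] dist_triangle[of u y' u'] by (simp add: dist_commute)
        ultimately have "dist y y' \<le> 3 * \<rho> (Suc k)" using u(2) u'(2) by simp
        then show False using Fsep y y' by force
      qed
      then have "(\<Sum>y\<in>F. V y i) = V y i" using F(1) y by (simp add: sum.remove)
      also have "\<dots> \<le> w i" by (simp add: V_def v)
      finally show ?thesis using meets by (simp add: v_def)
    qed
    \<comment> \<open>Averaging: at least \<open>R powr s\<close> children share a total weight of
      at most \<open>R powr s\<close> times the bound of the next level, so they cannot all exceed
      that bound.\<close>
    have "(\<Sum>y\<in>F. W (cball y (\<rho> (Suc k)))) = (\<Sum>i. \<Sum>y\<in>F. V y i)"
      unfolding W_def V_def by (rule suminf_sum[symmetric]) (rule vsum)
    also have "\<dots> \<le> W (cball x (\<rho> k))" unfolding W_def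
      by (intro suminf_le one vsum summable_sum) (simp add: V_def vsum)
    also have "\<dots> \<le> \<rho> (Suc k) powr s" using inv by (simp add: Inv_def)
    also have "\<dots> = R powr s * \<rho> (Suc (Suc k)) powr s"
      using \<rho>Suc[of "Suc k"] R \<rho>pos[of "Suc (Suc k)"] by (metis mult.commute powr_mult)
    also have "\<dots> \<le> card F * \<rho> (Suc (Suc k)) powr s" using F(3) by (intro mult_right_mono) auto
    finally have "(\<Sum>y\<in>F. W (cball y (\<rho> (Suc k)))) \<le> card F * \<rho> (Suc (Suc k)) powr s" .
    moreover have "card F * \<rho> (Suc (Suc k)) powr s < (\<Sum>y\<in>F. W (cball y (\<rho> (Suc k))))"
      if "\<forall>y\<in>F. \<rho> (Suc (Suc k)) powr s < W (cball y (\<rho> (Suc k)))"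
    proof -
      have "F \<noteq> {}" using \<open>card F > 0\<close> by auto
      then have "(\<Sum>y\<in>F. \<rho> (Suc (Suc k)) powr s) < (\<Sum>y\<in>F. W (cball y (\<rho> (Suc k))))"
        using that F(1) by (intro sum_strict_mono) auto
      then show ?thesis by simp
    qed
    ultimately obtain y where "y \<in> F" "W (cball y (\<rho> (Suc k))) \<le> \<rho> (Suc (Suc k)) powr s"
      by (meson not_le)
    then show ?thesis using F(2) FG unfolding Inv_def by blast
  qed
  ultimately obtain X where X: "\<And>k. Inv k (X k)"
    "\<And>k. cball (X (Suc k)) (\<rho> (Suc k)) \<subseteq> cball (X k) (\<rho> k) \<and> G k (X k) (X (Suc k))"
    using dependent_nat_choice[of Inv "\<lambda>k x y. cball y (\<rho> (Suc k)) \<subseteq> cball x (\<rho> k) \<and> G k x y"] by metis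
  have nest: "cball (X n) (\<rho> n) \<subseteq> cball (X k) (\<rho> k)" if "k \<le> n" for k n
    using that by (induction n rule: dec_induct) (use X(2) in auto)
  have XK: "X k \<in> K" for k using X(1) by (simp add: Inv_def)
  have Xn: "X n \<in> cball (X k) (\<rho> k)" if "k \<le> n" for k n
    using nest[OF that] \<rho>pos[of n] centre_in_cball[of "X n" "\<rho> n"] by (meson less_imp_le subsetD)
  \<comment> \<open>Compactness of \<open>K\<close> supplies a limit point of the centres; it lies
    in every ball because the balls are closed and nested.\<close>
  obtain z f where z: "z \<in> K" "strict_mono f" "(X \<circ> f) \<longlonglongrightarrow> z"
    using K(1) XK unfolding compact_def by blast
  have zX: "z \<in> cball (X k) (\<rho> k)" for k
  proof (rule Lim_in_closed_set[OF closed_cball _ _ z(3)])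
    show "\<forall>\<^sub>F n in sequentially. (X \<circ> f) n \<in> cball (X k) (\<rho> k)"
      using Xn seq_suble[OF z(2)] unfolding eventually_sequentially comp_def by (meson order_trans)
  qed simp
  have "z \<in> E" by (rule E[of z X]) (use z(1) XK X(2) zX in \<open>auto simp: \<rho>_def\<close>)
  then obtain i where i: "z \<in> U i" using U(1) by auto
  \<comment> \<open>The set containing the limit point meets every ball of the branch, so the
    invariant forces its positive weight below a null sequence.\<close>
  have "w i \<le> \<rho> (Suc k) powr s" for k
    using wW[of i "cball (X k) (\<rho> k)"] zX[of k] i X(1)[of k] by (force simp: Inv_def)
  moreover have "(\<lambda>k. \<rho> (Suc k) powr s) \<longlonglongrightarrow> 0"
    using LIMSEQ_Suc[OF \<rho>0] s \<rho>pos by (intro tendsto_zero_powrI[where b=s]) (auto simp: less_imp_le)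
  ultimately have "w i \<le> 0" by (meson LIMSEQ_le_const)
  then show False using wpos[of i] by simp
qed

section \<open>Determinant estimates and the simplex lemma\<close>

text \<open>Each term of the Leibniz expansion takes exactly one entry from column \<open>k\<close>,
  bounded by \<open>Q\<close>, and all its other entries from columns bounded by
  \<open>Q * t\<close>.\<close>

lemma abs_det_le_dominant_column:
  fixes A :: "real^'n^'n"
  assumes "Q \<ge> 0" "t \<ge> 0" "\<And>i. \<bar>A $ i $ k\<bar> \<le> Q" "\<And>i j. j \<noteq> k \<Longrightarrow> \<bar>A $ i $ j\<bar> \<le> Q * t"
  shows "\<bar>det A\<bar> \<le> fact CARD('n) * (Q ^ CARD('n) * t ^ (CARD('n) - 1))"
proof -
  have trm: "\<bar>of_int (sign p) * (\<Prod>i\<in>UNIV. A $ i $ p i)\<bar> \<le> Q ^ CARD('n) * t ^ (CARD('n) - 1)"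
    if p: "p permutes (UNIV :: 'n set)" for p
  proof -
    have "\<bar>of_int (sign p) * (\<Prod>i\<in>UNIV. A $ i $ p i)\<bar> = (\<Prod>i\<in>UNIV. \<bar>A $ i $ p i\<bar>)"
      by (simp add: abs_mult abs_prod sign_def)
    also have "\<dots> \<le> (\<Prod>i\<in>UNIV. Q * (if p i = k then 1 else t))"
      by (intro prod_mono) (use assms in auto)
    also have "\<dots> = Q ^ CARD('n) * (\<Prod>i\<in>UNIV. if p i = k then 1 else t)"
      by (simp add: prod.distrib)
    also have "(\<Prod>i\<in>UNIV. if p i = k then 1 else t) = (\<Prod>j\<in>UNIV. if j = k then 1 else t)"
      using prod.permute[OF p, of "\<lambda>j. if j = k then 1 else t"] by (simp add: comp_def)
    also have "\<dots> = (\<Prod>j\<in>UNIV - {k}. t)"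
      by (subst prod.remove[of _ k]) (auto intro!: prod.cong)
    also have "\<dots> = t ^ (CARD('n) - 1)" by (simp add: card_Diff_singleton)
    finally show ?thesis .
  qed
  have "\<bar>det A\<bar> \<le> (\<Sum>p | p permutes (UNIV :: 'n set). \<bar>of_int (sign p) * (\<Prod>i\<in>UNIV. A $ i $ p i)\<bar>)"
    unfolding det_def by (rule sum_abs)
  also have "\<dots> \<le> real (card {p. p permutes (UNIV :: 'n set)}) * (Q ^ CARD('n) * t ^ (CARD('n) - 1))"
    by (rule sum_bounded_above) (use trm in auto)
  finally show ?thesis by (simp add: card_permutations)
qed

text \<open>\<open>wedge_norm u q\<close> is the length of the component of \<open>q\<close>
  orthogonal to \<open>u\<close>, and a unit vector \<open>w\<close> orthogonal to \<open>u\<close>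
  sees only that component.\<close>

lemma inner_le_wedge_norm:
  fixes u q w :: "real^'n"
  assumes "norm u = 1" "norm w = 1" "u \<bullet> w = 0"
  shows "\<bar>q \<bullet> w\<bar> \<le> wedge_norm u q"
proof -
  have uu: "u \<bullet> u = 1" using assms(1) by (simp add: norm_eq_1)
  define p where "p = q - (q \<bullet> u) *\<^sub>R u"
  have "(norm p)\<^sup>2 = (wedge_norm u q)\<^sup>2"
    unfolding wedge_norm_squared power2_norm_eq_inner p_def
    by (simp add: uu inner_diff_left inner_diff_right inner_commute power2_eq_square algebra_simps)
  then have "norm p = wedge_norm u q" by (simp add: power2_eq_iff_nonneg wedge_norm_nonneg)
  moreover have "q \<bullet> w = p \<bullet> w" by (simp add: p_def inner_diff_left assms)
  ultimately show ?thesis using Cauchy_Schwarz_ineq2[of p w] assms(2) by simp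
qed

text \<open>Rotate so that \<open>u\<close> becomes a coordinate direction, which preserves the
  absolute value of the determinant. The rows are long only along \<open>u\<close>, so a single
  column can be large.\<close>

lemma abs_det_rows_near_line:
  fixes A :: "real^'n^'n"
  assumes "norm u = 1" "Q \<ge> 0" "t \<ge> 0"
    and "\<And>i. norm (A $ i) \<le> Q" "\<And>i. wedge_norm u (A $ i) \<le> Q * t"
  shows "\<bar>det A\<bar> \<le> fact CARD('n) * (Q ^ CARD('n) * t ^ (CARD('n) - 1))"
proof -
  fix k :: 'n
  obtain T :: "real^'n^'n" where T: "orthogonal_matrix T" "T *v axis k 1 = u"
    using orthogonal_matrix_exists_basis[OF assms(1)] by metis
  have col: "column k T = u" using T(2) by (simp add: matrix_vector_mult_basis)
  have ent: "(A ** T) $ i $ j = A $ i \<bullet> column j T" for i j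
    by (simp add: matrix_matrix_mult_def inner_vec_def column_def)
  have on: "norm (column j T) = 1" "j \<noteq> k \<Longrightarrow> u \<bullet> column j T = 0" for j
  proof -
    have "column i T \<bullet> column j T = (transpose T ** T) $ i $ j" for i j
      by (simp add: matrix_matrix_mult_def inner_vec_def column_def transpose_def)
    then have "column i T \<bullet> column j T = (if i = j then 1 else 0)" for i j
      using T(1) by (simp add: orthogonal_matrix_def mat_def)
    then show "norm (column j T) = 1" "j \<noteq> k \<Longrightarrow> u \<bullet> column j T = 0"
      by (auto simp: norm_eq_1 simp flip: col)
  qed
  have "\<bar>det (A ** T)\<bar> \<le> fact CARD('n) * (Q ^ CARD('n) * t ^ (CARD('n) - 1))"
  proof (rule abs_det_le_dominant_column[OF assms(2,3)])
    show "\<bar>(A ** T) $ i $ k\<bar> \<le> Q" for i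
      using Cauchy_Schwarz_ineq2[of "A $ i" u] assms(1) assms(4)[of i] unfolding ent col by simp
    show "\<bar>(A ** T) $ i $ j\<bar> \<le> Q * t" if "j \<noteq> k" for i j
      using inner_le_wedge_norm[OF assms(1) on(1) on(2)[OF that], of "A $ i"] assms(5)[of i]
      unfolding ent by simp
  qed
  moreover have "\<bar>det T\<bar> = 1" using det_orthogonal_matrix[OF T(1)] by auto
  ultimately show ?thesis by (simp add: det_mul abs_mult)
qed

lemma height_bounds:
  assumes "primitive_vec z"
  shows "\<bar>z $ i\<bar> \<le> height (proj_pt (real_vec z))" "height (proj_pt (real_vec z)) \<ge> 1"
proof -
  show le: "\<bar>z $ i\<bar> \<le> height (proj_pt (real_vec z))" for i
    unfolding height_proj_pt[OF assms] by (rule Max_ge) auto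
  obtain j where "z $ j \<noteq> 0" using assms by (auto simp: primitive_vec_def vec_eq_iff)
  then show "height (proj_pt (real_vec z)) \<ge> 1" using le[of j] by linarith
qed

text \<open>Serves to place vectors that span less than a hyperplane inside one of dimension exactly
  \<open>d\<close>: a basis of their span is enlarged within a basis of the whole space.\<close>

lemma subspace_dim_extend:
  fixes S :: "'a::euclidean_space set"
  assumes "dim S \<le> d" "d \<le> DIM('a)"
  obtains L where "subspace L" "dim L = d" "S \<subseteq> L"
proof -
  obtain B where B: "B \<subseteq> S" "independent B" "S \<subseteq> span B" "card B = dim S"
    using basis_exists[of S] by blast
  define B' where "B' = extend_basis B"
  have B': "B \<subseteq> B'" "independent B'" "span B' = UNIV"
    unfolding B'_def using extend_basis_superset independent_extend_basis span_extend_basis B(2) by auto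
  have fin: "finite B'" "card B' = DIM('a)"
    using B' independent_bound dim_eq_card[of B' UNIV] by (auto simp: dim_UNIV)
  have "\<exists>C. B \<subseteq> C \<and> C \<subseteq> B' \<and> card C = d"
    using exists_subset_between[of B d B'] B' B(4) assms fin by auto
  then obtain C where C: "B \<subseteq> C" "C \<subseteq> B'" "card C = d" by blast
  have "independent C" using C(2) B'(2) independent_mono by blast
  then have "dim (span C) = d" using C(3) by (metis dim_span_eq_card_independent)
  then show ?thesis using that[of "span C"] B(3) span_mono[OF C(1)] by auto
qed

text \<open>Otherwise \<open>N + 1\<close> independent primitive integer vectors form the rows of a
  matrix whose determinant is a nonzero integer, while the left side of \<open>small\<close> bounds
  its absolute value. The factor \<open>N + 1\<close> beside \<open>H\<close> comes from bounding
  the Euclidean norm by the sum of the coordinates.\<close>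

lemma rational_points_near_in_hyperplane:
  fixes p :: "'n::finite proj"
  assumes N: "CARD('n) = N + 1" and "H \<ge> 0" "t \<ge> 0"
    and small: "fact (N + 1) * ((real (N + 1) * H) ^ (N + 1) * t ^ N) < 1"
  obtains P :: "'n proj set" where "proj_hyperplane N P"
    "\<And>q. q \<in> rational_points \<Longrightarrow> dist p q \<le> t \<Longrightarrow> real_of_int (height q) \<le> H \<Longrightarrow> q \<in> P"
proof -
  obtain u0 where u0: "u0 \<noteq> 0" "p = proj_pt u0" by (rule proj_pt_cases)
  define u where "u = sgn u0"
  have u: "norm u = 1" "u \<noteq> 0" using u0 by (auto simp: u_def norm_sgn sgn_zero_iff)
  have pu: "p = proj_pt u" unfolding u0(2)
    by (subst proj_pt_eq_iff[OF u0(1) u(2)]) (use u0(1) in \<open>auto simp: u_def sgn_div_norm intro!: exI[of _ "inverse (norm u0)"]\<close>)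
  define S where "S = {real_vec z | z. primitive_vec z \<and> dist p (proj_pt (real_vec z)) \<le> t
    \<and> real_of_int (height (proj_pt (real_vec z))) \<le> H}"
  have "dim S \<le> N"
  proof (rule ccontr)
    assume "\<not> dim S \<le> N"
    moreover have "dim S \<le> N + 1" using dim_subset_UNIV[of S] N by simp
    ultimately have dS: "dim S = N + 1" by simp
    obtain B where B: "B \<subseteq> S" "independent B" "card B = N + 1"
      using basis_exists[of S] dS by metis
    obtain f where f: "bij_betw f (UNIV :: 'n set) B"
      using finite_same_card_bij[of "UNIV :: 'n set" B] B N independent_imp_finite by auto
    define A :: "real^'n^'n" where "A = (\<chi> i. f i)"
    have "rows A = B" using f unfolding rows_def row_def A_def by (auto simp: bij_betw_def vec_lambda_unique)
    then have "rank A = N + 1" using B by (simp add: row_rank_def dim_eq_card_independent)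
    then have "det A \<noteq> 0" using det_eq_0_rank[of A] N by simp
    have "\<forall>i. \<exists>z. f i = real_vec z \<and> primitive_vec z \<and> dist p (proj_pt (real_vec z)) \<le> t
      \<and> real_of_int (height (proj_pt (real_vec z))) \<le> H"
      using f B(1) unfolding bij_betw_def S_def by blast
    then obtain z where z: "\<And>i. f i = real_vec (z i)" "\<And>i. primitive_vec (z i)"
      "\<And>i. dist p (proj_pt (real_vec (z i))) \<le> t"
      "\<And>i. real_of_int (height (proj_pt (real_vec (z i)))) \<le> H" by metis
    have Ai: "A $ i = real_vec (z i)" for i by (simp add: A_def z)
    have "det A \<in> \<int>" unfolding det_def
      by (intro Ints_sum Ints_mult Ints_prod) (auto simp: Ai real_vec_def)
    then have "1 \<le> \<bar>det A\<bar>" using \<open>det A \<noteq> 0\<close> Ints_nonzero_abs_ge1 by blast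
    moreover have "\<bar>det A\<bar> \<le> fact CARD('n) * ((real (N + 1) * H) ^ CARD('n) * t ^ (CARD('n) - 1))"
    proof (rule abs_det_rows_near_line[OF u(1) _ assms(3)])
      show le: "norm (A $ i) \<le> real (N + 1) * H" for i
      proof -
        have "norm (A $ i) \<le> (\<Sum>j\<in>UNIV. \<bar>A $ i $ j\<bar>)" by (rule norm_le_l1_cart)
        also have "\<dots> \<le> real CARD('n) * H"
        proof (rule sum_bounded_above)
          fix j
          have "\<bar>A $ i $ j\<bar> = real_of_int \<bar>z i $ j\<bar>" by (simp add: Ai real_vec_def)
          also have "\<dots> \<le> H" using height_bounds(1)[OF z(2), of i j] z(4)[of i] by linarith
          finally show "\<bar>A $ i $ j\<bar> \<le> H" .
        qed
        finally show ?thesis using N by simp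
      qed
      show "wedge_norm u (A $ i) \<le> real (N + 1) * H * t" for i
      proof -
        have nz: "real_vec (z i) \<noteq> 0" using z(2)[of i] by (simp add: primitive_vec_def real_vec_eq_0_iff)
        have "wedge_norm u (A $ i) / norm (A $ i) \<le> t"
          using z(3)[of i] unfolding pu dist_proj_pt[OF u(2) nz] Ai using u(1) by simp
        then have "wedge_norm u (A $ i) \<le> norm (A $ i) * t"
          using nz by (simp add: Ai field_simps)
        also have "\<dots> \<le> real (N + 1) * H * t" by (intro mult_right_mono le assms)
        finally show ?thesis .
      qed
      show "0 \<le> real (N + 1) * H" using assms by simp
    qed
    ultimately show False using small N by simp
  qed
  then obtain L where L: "subspace L" "dim L = N" "S \<subseteq> L"
    using subspace_dim_extend[of S N] N by auto
  show ?thesis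
  proof (rule that)
    show "proj_hyperplane N (proj_pt ` (L - {0}))" unfolding proj_hyperplane_def using L by blast
    fix q :: "'n proj"
    assume q: "q \<in> rational_points" "dist p q \<le> t" "real_of_int (height q) \<le> H"
    obtain z where z: "primitive_vec z" "q = proj_pt (real_vec z)" by (rule rational_points_primitive[OF q(1)])
    then have "real_vec z \<in> S" using q unfolding S_def by blast
    moreover have "real_vec z \<noteq> 0" using z(1) by (simp add: primitive_vec_def real_vec_eq_0_iff)
    ultimately show "q \<in> proj_pt ` (L - {0})" using L(3) z(2) by blast
  qed
qed

text \<open>One \<open>c0\<close> serves all points and radii because the determinant bound depends
  on height and radius only through the scale-invariant product of \<open>H ^ (N + 1)\<close> and
  \<open>r ^ N\<close>. The radius is \<open>2 * r\<close> so that points beyond it are at least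
  \<open>r\<close> away from anything within \<open>r\<close> of \<open>p\<close>.\<close>

lemma simplex_lemma:
  assumes N: "CARD('n::finite) = N + 1" "N \<ge> 1"
  obtains c0 where "c0 > 0" "\<And>(p :: 'n proj) r. r > 0 \<Longrightarrow> \<exists>P. proj_hyperplane N P \<and>
    (\<forall>q\<in>rational_points. dist p q \<le> 2 * r \<and> real_of_int (height q) powr (real (N + 1) / real N) * r \<le> c0 \<longrightarrow> q \<in> P)"
proof -
  \<comment> \<open>All constants of the determinant bound at distance \<open>2 * r\<close>, whence
    the power of 2.\<close>
  define D :: real where "D = fact (N + 1) * real (N + 1) ^ (N + 1) * 2 ^ N"
  have D: "D \<ge> 1"
    unfolding D_def using fact_ge_1[of "N+1", where 'a=real] one_le_power[of "real (N+1)" "N+1"] one_le_power[of "2::real" N]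
    by (smt (verit) mult_le_cancel_left1 of_nat_1 of_nat_mono le_add2)
  define c0 where "c0 = 1 / (2 * D)"
  have c0: "0 < c0" "c0 \<le> 1" "D * c0 < 1" using D by (auto simp: c0_def field_simps)
  show ?thesis
  proof (rule that[OF c0(1)])
    fix p :: "'n proj" and r :: real assume r: "r > 0"
    \<comment> \<open>The height at which the condition on \<open>height q\<close> becomes an
      equality.\<close>
    define H where "H = (c0 / r) powr (real N / real (N + 1))"
    have "H ^ (N + 1) = (c0 / r) ^ N"
    proof -
      have "H ^ (N + 1) = H powr real (N + 1)" using c0 r by (subst powr_realpow) (auto simp: H_def)
      also have "\<dots> = (c0 / r) powr real N" by (simp add: H_def powr_powr del: of_nat_Suc of_nat_add)
      finally show ?thesis using c0 r by (simp add: powr_realpow)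
    qed
    then have "fact (N + 1) * ((real (N + 1) * H) ^ (N + 1) * (2 * r) ^ N) = D * c0 ^ N"
      using r by (simp add: D_def power_mult_distrib power_divide del: power_Suc)
    also have "\<dots> \<le> D * c0"
      using c0 D N power_decreasing[of 1 N c0] by (intro mult_left_mono) auto
    finally have "fact (N + 1) * ((real (N + 1) * H) ^ (N + 1) * (2 * r) ^ N) < 1" using c0(3) by linarith
    then obtain P :: "'n proj set" where P: "proj_hyperplane N P"
      "\<And>q. q \<in> rational_points \<Longrightarrow> dist p q \<le> 2 * r \<Longrightarrow> real_of_int (height q) \<le> H \<Longrightarrow> q \<in> P"
      using rational_points_near_in_hyperplane[OF N(1), of H "2 * r" p] r by (auto simp: H_def)
    have "real_of_int (height q) \<le> H"
      if q: "q \<in> rational_points" "real_of_int (height q) powr (real (N + 1) / real N) * r \<le> c0" for q :: "'n proj"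
    proof -
      obtain z where "primitive_vec z" "q = proj_pt (real_vec z)" by (rule rational_points_primitive[OF q(1)])
      then have h: "height q \<ge> 1" using height_bounds(2) by blast
      have "real_of_int (height q) powr (real (N + 1) / real N) \<le> c0 / r" using q(2) r by (simp add: field_simps)
      then have "(real_of_int (height q) powr (real (N + 1) / real N)) powr (real N / real (N + 1)) \<le> H"
        unfolding H_def by (intro powr_mono2) auto
      then show ?thesis using h N by (simp add: powr_powr)
    qed
    then show "\<exists>P. proj_hyperplane N P \<and>
      (\<forall>q\<in>rational_points. dist p q \<le> 2 * r \<and> real_of_int (height q) powr (real (N + 1) / real N) * r \<le> c0 \<longrightarrow> q \<in> P)"
      using P by blast
  qed
qed

section \<open>Vanishing of Hausdorff measure above the regularity exponent\<close>

lemma diameter_cball_le: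
  fixes x :: "'a::metric_space"
  assumes "t \<ge> 0"
  shows "diameter (cball x t) \<le> 2 * t"
proof -
  have "dist y z \<le> 2 * t" if "y \<in> cball x t" "z \<in> cball x t" for y z
    using that dist_triangle3[of y z x] by simp
  moreover have "x \<in> cball x t" using assms by simp
  ultimately show ?thesis unfolding diameter_def
    by (subst if_not_P) (force, intro cSUP_least, auto)
qed

lemma hausdorff_pre_le_card_cballs:
  fixes A :: "'a::metric_space set"
  assumes "finite F" "A \<subseteq> (\<Union>y\<in>F. cball y t)" "t > 0" "2 * t \<le> \<epsilon>" "s > 0"
  shows "hausdorff_pre s \<epsilon> A \<le> ennreal (card F * (2 * t) powr s)"
proof -
  obtain h where h: "bij_betw h {0..<card F} F" using ex_bij_betw_nat_finite[OF assms(1)] by blast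
  \<comment> \<open>The sequence is padded with empty sets, whose diameter is 0 and which add
    \<open>0 powr s = 0\<close> to the sum.\<close>
  define U where "U i = (if i < card F then cball (h i) t else {})" for i
  have d: "diameter (U i) \<le> 2 * t" for i using diameter_cball_le[of t "h i"] assms(3) by (simp add: U_def)
  have dn: "0 \<le> diameter (U i)" for i by (simp add: U_def diameter_ge_0)
  have "(\<Union>y\<in>F. cball y t) \<subseteq> (\<Union>i. U i)"
  proof
    fix z assume "z \<in> (\<Union>y\<in>F. cball y t)"
    then obtain y where y: "y \<in> F" "z \<in> cball y t" by blast
    then obtain i where "i < card F" "h i = y" using h unfolding bij_betw_def by (metis imageE atLeastLessThan_iff)
    then show "z \<in> (\<Union>i. U i)" using y by (auto simp: U_def)
  qed
  with assms(2) have "A \<subseteq> (\<Union>i. U i)" by (rule order_trans)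
  moreover have "bounded (U i) \<and> diameter (U i) \<le> \<epsilon>" for i
    using d[of i] assms(4) by (simp add: U_def)
  ultimately have "hausdorff_pre s \<epsilon> A \<le> (\<Sum>i. ennreal (diameter (U i) powr s))"
    unfolding hausdorff_pre_def by (intro INF_lower[of U]) simp
  also have "\<dots> = (\<Sum>i<card F. ennreal (diameter (U i) powr s))"
    by (rule suminf_finite) (auto simp: U_def)
  also have "\<dots> \<le> (\<Sum>i<card F. ennreal ((2 * t) powr s))"
    by (intro sum_mono ennreal_leI powr_mono2 d dn) (use assms in auto)
  also have "\<dots> = ennreal (card F * (2 * t) powr s)"
    by (simp add: ennreal_mult ennreal_of_nat_eq_real_of_nat)
  finally show ?thesis .
qed

lemma hausdorff_measure_mono: "A \<subseteq> B \<Longrightarrow> hausdorff_measure s A \<le> hausdorff_measure s B"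
  unfolding hausdorff_measure_def hausdorff_pre_def
  by (intro SUP_mono' INF_superset_mono) auto

lemma hausdorff_dim_mono: "A \<subseteq> B \<Longrightarrow> hausdorff_dim A \<le> hausdorff_dim B"
  unfolding hausdorff_dim_def
  by (rule Inf_superset_mono) (auto, metis hausdorff_measure_mono le_zero_eq)

text \<open>Volume packing: balls of radius \<open>t / 2\<close> about a \<open>t\<close>-separated
  net are disjoint, so the net has at most a constant times \<open>t powr (-\<delta>)\<close>
  points. The balls of radius \<open>t\<close> about it then have an \<open>s\<close>-sum of order
  \<open>t powr (s - \<delta>)\<close>.\<close>

lemma hausdorff_measure_eq_0_of_lower_regular:
  fixes K :: "'a::metric_space set"
  assumes "finite_measure m" "sets m = sets borel" "compact K"
    and a: "a > 0" "r0 > 0" "\<And>x r. x \<in> K \<Longrightarrow> 0 < r \<Longrightarrow> r \<le> r0 \<Longrightarrow> a * r powr \<delta> \<le> measure m (cball x r)"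
    and s: "0 < s" "\<delta> < s"
  shows "hausdorff_measure s K = 0"
proof -
  interpret finite_measure m by fact
  define M where "M = measure m (space m)"
  have pre: "hausdorff_pre s \<epsilon> K \<le> ennreal (M / a * 2 powr (s + \<delta>) * t powr (s - \<delta>))"
    if t: "t > 0" "t \<le> r0" "2 * t \<le> \<epsilon>" for t \<epsilon>
  proof -
    obtain F where F: "finite F" "F \<subseteq> K" "\<And>x y. x \<in> F \<Longrightarrow> y \<in> F \<Longrightarrow> x \<noteq> y \<Longrightarrow> dist x y > t"
      "K \<subseteq> (\<Union>y\<in>F. cball y t)" using finite_separated_cover[OF assms(3) order_refl t(1)] by metis
    have disj: "disjoint_family_on (\<lambda>y. cball y (t / 2)) F"
    unfolding disjoint_family_on_def
    proof (intro ballI impI, rule ccontr)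
      fix x y assume xy: "x \<in> F" "y \<in> F" "x \<noteq> y" "cball x (t / 2) \<inter> cball y (t / 2) \<noteq> {}"
      then obtain z where "dist x z \<le> t / 2" "dist y z \<le> t / 2" by auto
      then have "dist x y \<le> t" using dist_triangle2[of x y z] by simp
      then show False using F(3) xy by force
    qed
    have "card F * (a * (t / 2) powr \<delta>) = (\<Sum>y\<in>F. a * (t / 2) powr \<delta>)" by simp
    also have "\<dots> \<le> (\<Sum>y\<in>F. measure m (cball y (t / 2)))"
      by (intro sum_mono a) (use t F(2) in auto)
    also have "\<dots> = measure m (\<Union>y\<in>F. cball y (t / 2))"
      by (rule finite_measure_finite_Union[OF F(1) _ disj, symmetric]) (auto simp: assms(2))
    also have "\<dots> \<le> M" unfolding M_def by (rule bounded_measure)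
    finally have "real (card F) \<le> M / (a * (t / 2) powr \<delta>)" using a t by (simp add: pos_le_divide_eq)
    then have "card F * (2 * t) powr s \<le> M / (a * (t / 2) powr \<delta>) * (2 * t) powr s"
      by (rule mult_right_mono) simp
    also have "\<dots> = M / a * 2 powr (s + \<delta>) * t powr (s - \<delta>)"
      using t by (simp add: powr_mult powr_divide powr_add powr_diff)
    finally show ?thesis
      using hausdorff_pre_le_card_cballs[OF F(1,4) t(1,3) s(1)] by (meson ennreal_leI order_trans)
  qed
  \<comment> \<open>With \<open>\<epsilon>\<close> fixed, the radius \<open>t\<close> of the cover
    can still tend to 0.\<close>
  have "hausdorff_pre s \<epsilon> K = 0" if \<epsilon>: "\<epsilon> > 0" for \<epsilon>
  proof -
    have "((\<lambda>t. t powr (s - \<delta>)) \<longlongrightarrow> 0) (at_right 0)"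
      using s by (intro tendsto_zero_powrI[where b="s - \<delta>"])
        (auto simp: eventually_at_right_less intro!: tendsto_ident_at eventually_at_rightI[of 0 1])
    then have "((\<lambda>t. M / a * 2 powr (s + \<delta>) * t powr (s - \<delta>)) \<longlongrightarrow> 0) (at_right 0)"
      by (rule tendsto_mult_right_zero)
    then have lim: "((\<lambda>t. ennreal (M / a * 2 powr (s + \<delta>) * t powr (s - \<delta>))) \<longlongrightarrow> ennreal 0) (at_right 0)"
      by (rule tendsto_ennrealI)
    have "hausdorff_pre s \<epsilon> K \<le> ennreal 0"
    proof (rule tendsto_lowerbound[OF lim])
      show "\<forall>\<^sub>F t in at_right 0. hausdorff_pre s \<epsilon> K \<le> ennreal (M / a * 2 powr (s + \<delta>) * t powr (s - \<delta>))"
        by (rule eventually_at_rightI[of 0 "min r0 (\<epsilon> / 2)"]) (use pre \<epsilon> a in auto)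
    qed simp
    then show ?thesis by simp
  qed
  then show ?thesis unfolding hausdorff_measure_def by simp
qed

section \<open>Finite measures on a compact set and points away from a hyperplane\<close>

text \<open>Finitely many open sets of finite measure cover the support, and the rest is null.
  Finiteness lets the later estimates be carried out in the reals.\<close>

lemma finite_measure_of_compact_support:
  fixes K :: "'a::metric_space set"
  assumes "compact K" "locally_finite_borel m" "supported_on m K"
  shows "finite_measure m"
proof
  have sets: "sets m = sets borel" and sp: "space m = UNIV"
    using assms(2) sets_eq_imp_space_eq[of m borel] by (auto simp: locally_finite_borel_def)
  have "\<forall>x. \<exists>U. open U \<and> x \<in> U \<and> emeasure m U < \<infinity>" using assms(2) by (auto simp: locally_finite_borel_def)
  then obtain U where U: "\<And>x. open (U x)" "\<And>x. x \<in> U x" "\<And>x. emeasure m (U x) < \<infinity>" by metis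
  have "K \<subseteq> (\<Union>x\<in>K. U x)" using U(2) by blast
  then obtain D where D: "finite D" "K \<subseteq> (\<Union>x\<in>D. U x)"
    by (rule compactE_image[OF assms(1) U(1)])
  have meas: "U x \<in> sets m" "- K \<in> sets m" for x
    using U(1) compact_imp_closed[OF assms(1)] by (auto simp: sets)
  have "emeasure m (space m) \<le> emeasure m (- K \<union> (\<Union>x\<in>D. U x))"
    by (rule emeasure_mono) (use D meas in \<open>auto simp: sp\<close>)
  also have "\<dots> \<le> emeasure m (- K) + emeasure m (\<Union>x\<in>D. U x)"
    by (rule emeasure_subadditive) (use D meas in auto)
  also have "\<dots> \<le> 0 + (\<Sum>x\<in>D. emeasure m (U x))"
    using assms(3) unfolding supported_on_def
    by (intro add_mono emeasure_subadditive_finite) (use D meas in auto)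
  also have "\<dots> < \<infinity>" using U(3) D(1) by (simp add: less_top)
  finally show "emeasure m (space m) \<noteq> \<infinity>" by simp
qed

text \<open>The part of \<open>K\<close> in the ball and outside \<open>T\<close> carries at least
  half of the mass of the ball, as the complement of \<open>K\<close> is null. The balls of radius
  \<open>e\<close> about a maximal separated subset cover this part, each with mass at most
  \<open>\<beta>\<close>.\<close>

lemma many_separated_points_avoiding:
  fixes K :: "'a::metric_space set" and \<beta> :: real
  assumes "finite_measure m" "sets m = sets borel" "compact K" "supported_on m K" "open T"
    and half: "measure m (cball x r \<inter> T) \<le> measure m (cball x r) / 2"
    and e: "e > 0" "\<And>y. y \<in> K \<Longrightarrow> measure m (cball y e) \<le> \<beta>"
  obtains F where "finite F" "F \<subseteq> K" "\<And>y. y \<in> F \<Longrightarrow> dist x y \<le> r \<and> y \<notin> T"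
    "\<And>y z. y \<in> F \<Longrightarrow> z \<in> F \<Longrightarrow> y \<noteq> z \<Longrightarrow> dist y z > e"
    "measure m (cball x r) / 2 \<le> card F * \<beta>"
proof -
  interpret finite_measure m by fact
  have "K \<inter> cball x r - T \<subseteq> K" by blast
  then obtain F where F: "finite F" "F \<subseteq> K \<inter> cball x r - T"
    "\<And>x y. x \<in> F \<Longrightarrow> y \<in> F \<Longrightarrow> x \<noteq> y \<Longrightarrow> dist x y > e" "K \<inter> cball x r - T \<subseteq> (\<Union>y\<in>F. cball y e)"
    using finite_separated_cover[OF assms(3) _ e(1)] by metis
  have meas: "- K \<in> sets m" "T \<in> sets m" "cball y t \<in> sets m" for y t
    using assms(5) compact_imp_closed[OF assms(3)] by (auto simp: assms(2))
  have meas': "cball x r \<inter> T \<in> sets m" "(\<Union>y\<in>F. cball y e) \<in> sets m"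
    using meas F(1) by auto
  have null: "measure m (- K) = 0" using assms(4) by (simp add: supported_on_def measure_def)
  have "measure m (cball x r) \<le> measure m (- K \<union> (cball x r \<inter> T \<union> (\<Union>y\<in>F. cball y e)))"
    by (rule finite_measure_mono) (use F(4) in blast, intro sets.Un meas meas')
  also have "\<dots> \<le> measure m (- K) + measure m (cball x r \<inter> T \<union> (\<Union>y\<in>F. cball y e))"
    by (intro measure_Un_le sets.Un meas meas')
  also have "\<dots> \<le> measure m (- K) + (measure m (cball x r \<inter> T) + measure m (\<Union>y\<in>F. cball y e))"
    by (intro add_left_mono measure_Un_le meas')
  also have "measure m (\<Union>y\<in>F. cball y e) \<le> (\<Sum>y\<in>F. measure m (cball y e))"
    by (rule finite_measure_subadditive_finite) (use F meas in auto)
  also have "\<dots> \<le> card F * \<beta>" by (rule sum_bounded_above) (use F e in auto)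
  finally have "measure m (cball x r) / 2 \<le> card F * \<beta>" using half null by simp
  moreover have "F \<subseteq> K" "\<And>y. y \<in> F \<Longrightarrow> dist x y \<le> r \<and> y \<notin> T" using F(2) by auto
  ultimately show ?thesis using that[OF F(1)] F(3) by simp
qed

lemma open_thickening: "open (thickening P \<epsilon>)"
\<comment> \<open>For empty \<open>P\<close> the infimum is one fixed real number for all points,
  whereas \<open>infdist\<close> is 0 by convention; the thickening is then empty or
  everything.\<close>
proof (cases "P = {}")
  case False
  then have "thickening P \<epsilon> = {x. infdist x P < \<epsilon>}" by (simp add: thickening_def infdist_def)
  then show ?thesis by (simp add: open_Collect_less continuous_on_infdist continuous_on_id)
qed (simp add: thickening_def)

lemma dist_ge_if_not_in_thickening:
  assumes "x \<notin> thickening P \<epsilon>" "q \<in> P"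
  shows "\<epsilon> \<le> dist x q"
proof -
  have "(INF y\<in>P. dist x y) \<le> dist x q" by (rule cINF_lower) (use assms(2) in \<open>auto intro!: bdd_belowI2[of _ 0]\<close>)
  then show ?thesis using assms(1) by (simp add: thickening_def)
qed

section \<open>Bad approximability tested at geometric scales\<close>

text \<open>For each rational point take the first scale at which the hypothesis applies. At scale 0
  the height factor is at least 1; otherwise the previous scale fails the condition, so the factor
  times the current radius exceeds \<open>c0 / R\<close>.\<close>

lemma BadI_geometric_scales:
  fixes z :: "'n::finite proj"
  assumes "r0 > 0" "R > 1" "\<gamma> > 0" "c0 > 0"
    and far: "\<And>k q. q \<in> rational_points \<Longrightarrow>
      real_of_int (height q) powr (real (N + 1) / real N) * (r0 / R ^ k) \<le> c0 \<Longrightarrow> \<gamma> * (r0 / R ^ k) \<le> dist z q"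
  shows "z \<in> Bad N"
proof -
  define \<theta> where "\<theta> = real (N + 1) / real N"
  have "min (\<gamma> * r0) (\<gamma> * c0 / R) \<le> (INF q\<in>rational_points. real_of_int (height q) powr \<theta> * dist z q)"
  proof (rule cINF_greatest)
    \<comment> \<open>A lower bound passes to a real infimum only over a nonempty set; the point
      with all coordinates 1 is a witness.\<close>
    have "proj_pt (1 :: real^'n) \<in> rational_points" unfolding rational_points_def by force
    then show "(rational_points :: 'n proj set) \<noteq> {}" by blast
    fix q :: "'n proj" assume q: "q \<in> rational_points"
    define h where "h = real_of_int (height q) powr \<theta>"
    obtain w where "primitive_vec w" "q = proj_pt (real_vec w)" by (rule rational_points_primitive[OF q])
    then have "height q \<ge> 1" using height_bounds(2) by blast
    then have h: "h \<ge> 1" unfolding h_def by (intro ge_one_powr_ge_zero) (auto simp: \<theta>_def)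
    have "(\<lambda>k. h * (r0 / R ^ k)) \<longlonglongrightarrow> h * 0"
      by (intro tendsto_mult_left LIMSEQ_divide_realpow_zero assms)
    then have "\<forall>\<^sub>F k in sequentially. h * (r0 / R ^ k) < c0" using assms(4) by (intro order_tendstoD) auto
    then have ex: "\<exists>k. h * (r0 / R ^ k) \<le> c0" by (meson eventually_sequentially order_refl less_imp_le)
    define k where "k = (LEAST k. h * (r0 / R ^ k) \<le> c0)"
    have k: "h * (r0 / R ^ k) \<le> c0" unfolding k_def by (rule LeastI_ex[OF ex])
    have d: "\<gamma> * (r0 / R ^ k) \<le> dist z q" using far[OF q] k by (simp add: h_def \<theta>_def)
    show "min (\<gamma> * r0) (\<gamma> * c0 / R) \<le> real_of_int (height q) powr \<theta> * dist z q"
    proof (cases k)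
      case 0
      then have "1 * (\<gamma> * r0) \<le> h * dist z q" using d h assms by (intro mult_mono) auto
      then show ?thesis by (simp add: h_def)
    next
      case (Suc j)
      have "\<not> h * (r0 / R ^ j) \<le> c0" using not_less_Least[of j "\<lambda>k. h * (r0 / R ^ k) \<le> c0"] Suc
        by (simp add: k_def)
      then have "\<gamma> * c0 / R \<le> \<gamma> * (h * (r0 / R ^ j)) / R"
        using assms by (intro divide_right_mono mult_left_mono) auto
      also have "\<dots> = h * (\<gamma> * (r0 / R ^ k))" by (simp add: Suc mult_ac)
      also have "\<dots> \<le> h * dist z q" using d h by (intro mult_left_mono) auto
      finally show ?thesis by (simp add: h_def)
    qed
  qed
  moreover have "0 < min (\<gamma> * r0) (\<gamma> * c0 / R)" using assms by simp
  ultimately show ?thesis unfolding Bad_def \<theta>_def mem_Collect_eq by (rule less_le_trans[rotated])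
qed

section \<open>Regularity and decay as inequalities between real numbers\<close>

lemma ahlfors_regular_measure:
  fixes m :: "'a::metric_space measure"
  assumes "finite_measure m" "ahlfors_regular \<delta> K m"
  obtains r0 a b where "r0 > 0" "a > 0" "b > 0"
    "\<And>x r. x \<in> K \<Longrightarrow> 0 < r \<Longrightarrow> r \<le> r0 \<Longrightarrow> a * r powr \<delta> \<le> measure m (cball x r)"
    "\<And>x r. x \<in> K \<Longrightarrow> 0 < r \<Longrightarrow> r \<le> r0 \<Longrightarrow> measure m (cball x r) \<le> b * r powr \<delta>"
proof -
  interpret finite_measure m by fact
  obtain \<rho> a b where *: "\<rho> > 0" "0 < a" "1 \<le> b"
    "\<forall>x\<in>K. \<forall>r. 0 < r \<and> r < \<rho> \<and> r \<le> sin 1 \<longrightarrow> ennreal (a * r powr \<delta>) \<le> emeasure m (cball x r) \<and>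
        emeasure m (cball x r) \<le> ennreal (b * r powr \<delta>)"
    using assms(2) unfolding ahlfors_regular_def by metis
  have sin1: "sin 1 > (0::real)" by (rule sin_gt_zero) (use pi_gt3 in auto)
  show ?thesis
  proof (rule that[of "min (\<rho> / 2) (sin 1)" a b])
    fix x r assume xr: "x \<in> K" "0 < r" "r \<le> min (\<rho> / 2) (sin 1)"
    then have "r < \<rho>" "r \<le> sin 1" using *(1) by auto
    then have "ennreal (a * r powr \<delta>) \<le> ennreal (measure m (cball x r))"
      "ennreal (measure m (cball x r)) \<le> ennreal (b * r powr \<delta>)"
      using *(4) xr(1,2) by (simp_all add: emeasure_eq_measure)
    then show "a * r powr \<delta> \<le> measure m (cball x r)" "measure m (cball x r) \<le> b * r powr \<delta>"
      using * by simp_all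
  qed (use * sin1 in auto)
qed

lemma proj_abs_decaying_measure:
  fixes m :: "'n::finite proj measure"
  assumes "finite_measure m" "proj_abs_decaying N \<eta> K m" "\<eta> > 0"
  obtains r0 \<beta> where "r0 > 0" "\<beta> > 0" "\<beta> \<le> 1"
    "\<And>P x r. proj_hyperplane N P \<Longrightarrow> x \<in> K \<Longrightarrow> 0 < r \<Longrightarrow> r \<le> r0 \<Longrightarrow>
      measure m (cball x r \<inter> thickening P (\<beta> * r)) \<le> measure m (cball x r) / 2"
proof -
  interpret finite_measure m by fact
  obtain c \<rho> where *: "c > 0" "\<rho> > 0"
    "\<forall>P \<epsilon>. proj_hyperplane N P \<and> \<epsilon> > 0 \<longrightarrow> (\<forall>x\<in>K. \<forall>r. 0 < r \<and> r < \<rho> \<and> r \<le> sin 1 \<longrightarrow>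
          emeasure m (cball x r \<inter> thickening P \<epsilon>) \<le> ennreal (c * (\<epsilon> / r) powr \<eta>) * emeasure m (cball x r))"
    using assms(2) unfolding proj_abs_decaying_def by metis
  have sin1: "sin 1 > (0::real)" by (rule sin_gt_zero) (use pi_gt3 in auto)
  \<comment> \<open>Chosen so that \<open>c * \<beta> powr \<eta>\<close> is at most one half; the
    cap at 1 later gives \<open>R\<close> at least 4.\<close>
  define \<beta> where "\<beta> = min 1 ((1 / (2 * c)) powr (1 / \<eta>))"
  have \<beta>: "\<beta> > 0" "\<beta> \<le> 1" using *(1) by (auto simp: \<beta>_def)
  have "\<beta> powr \<eta> \<le> ((1 / (2 * c)) powr (1 / \<eta>)) powr \<eta>"
    by (rule powr_mono2) (use \<beta> assms(3) in \<open>auto simp: \<beta>_def\<close>)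
  also have "\<dots> = 1 / (2 * c)" using *(1) assms(3) by (simp add: powr_powr)
  finally have c\<beta>: "c * \<beta> powr \<eta> \<le> 1 / 2" using *(1) by (simp add: field_simps)
  show ?thesis
  proof (rule that[of "min (\<rho> / 2) (sin 1)" \<beta>])
    fix P :: "'n proj set" and x r assume xr: "proj_hyperplane N P" "x \<in> K" "0 < r" "r \<le> min (\<rho> / 2) (sin 1)"
    then have r: "r < \<rho>" "r \<le> sin 1" using *(2) by auto
    have "\<beta> * r > 0" using \<beta> xr by simp
    then have "emeasure m (cball x r \<inter> thickening P (\<beta> * r))
        \<le> ennreal (c * ((\<beta> * r) / r) powr \<eta>) * emeasure m (cball x r)"
      using *(3) xr r by blast
    then have "ennreal (measure m (cball x r \<inter> thickening P (\<beta> * r)))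
        \<le> ennreal (c * \<beta> powr \<eta> * measure m (cball x r))"
      using xr(3) *(1) by (simp add: emeasure_eq_measure ennreal_mult)
    then have "measure m (cball x r \<inter> thickening P (\<beta> * r)) \<le> c * \<beta> powr \<eta> * measure m (cball x r)"
      using *(1) by simp
    also have "\<dots> \<le> 1 / 2 * measure m (cball x r)" by (intro mult_right_mono c\<beta>) simp
    finally show "measure m (cball x r \<inter> thickening P (\<beta> * r)) \<le> measure m (cball x r) / 2" by simp
  qed (use * sin1 \<beta> in auto)
qed

section \<open>The tree of balls avoiding rational points, and the dimension\<close>

lemma hausdorff_measure_Bad_nonzero:
  fixes \<Omega> :: "'n::finite proj set"
  assumes N: "N \<ge> 1" "CARD('n) = N + 1" and \<Omega>: "\<Omega> \<noteq> {}" "compact \<Omega>"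
    and m: "finite_measure m" "sets m = sets borel" "supported_on m \<Omega>"
    and \<eta>: "\<eta> > 0" and reg: "ahlfors_regular \<delta> \<Omega> m" and dec: "proj_abs_decaying N \<eta> \<Omega> m"
    and s: "0 < s" "s < \<delta>"
  shows "hausdorff_measure s (Bad N \<inter> \<Omega>) \<noteq> 0"
proof -
  obtain r1 a b where A: "r1 > 0" "a > 0" "b > 0"
    and lower: "\<And>x r. x \<in> \<Omega> \<Longrightarrow> 0 < r \<Longrightarrow> r \<le> r1 \<Longrightarrow> a * r powr \<delta> \<le> measure m (cball x r)"
    and upper: "\<And>x r. x \<in> \<Omega> \<Longrightarrow> 0 < r \<Longrightarrow> r \<le> r1 \<Longrightarrow> measure m (cball x r) \<le> b * r powr \<delta>"
    using ahlfors_regular_measure[OF m(1) reg] by metis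
  obtain r2 \<beta> where B: "r2 > 0" "\<beta> > 0" "\<beta> \<le> 1"
    and half: "\<And>P x r. proj_hyperplane N P \<Longrightarrow> x \<in> \<Omega> \<Longrightarrow> 0 < r \<Longrightarrow> r \<le> r2 \<Longrightarrow>
      measure m (cball x r \<inter> thickening P (\<beta> * r)) \<le> measure m (cball x r) / 2"
    using proj_abs_decaying_measure[OF m(1) dec \<eta>] by metis
  define \<theta> where "\<theta> = real (N + 1) / real N"
  obtain c0 where c0: "c0 > 0" "\<And>(p :: 'n proj) r. r > 0 \<Longrightarrow> \<exists>P. proj_hyperplane N P \<and>
    (\<forall>q\<in>rational_points. dist p q \<le> 2 * r \<and> real_of_int (height q) powr \<theta> * r \<le> c0 \<longrightarrow> q \<in> P)"
    using simplex_lemma[OF N(2,1)] unfolding \<theta>_def by metis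
  define r0 where "r0 = min r1 r2"
  \<comment> \<open>The thickening at radius \<open>r / 2\<close> has width
    \<open>\<beta> * (r / 2) = 2 * \<gamma> * r\<close>; half of this is given up when passing from
    the centre of a child to its other points.\<close>
  define \<gamma> where "\<gamma> = \<beta> / 4"
  \<comment> \<open>The first entry makes the child radius at most \<open>\<gamma> * r\<close>. The
    second makes \<open>a / (2 * b) * (R / 8) powr \<delta>\<close>, a lower bound for the number of
    children, at least \<open>R powr s\<close>.\<close>
  define R where "R = max (4 / \<beta>) ((2 * b / a * 8 powr \<delta>) powr (1 / (\<delta> - s)))"
  have r0: "r0 > 0" "r0 \<le> r1" "r0 \<le> r2" using A B by (auto simp: r0_def)
  have \<gamma>: "\<gamma> > 0" using B by (simp add: \<gamma>_def)
  have "4 \<le> 4 / \<beta>" using B by (simp add: pos_le_divide_eq)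
  then have R4: "R \<ge> 4" unfolding R_def by linarith
  have R\<gamma>: "1 / R \<le> \<gamma>"
  proof -
    have "4 / \<beta> \<le> R" by (simp add: R_def)
    then show ?thesis using B R4 by (simp add: \<gamma>_def field_simps)
  qed
  have "2 * b / a * 8 powr \<delta> = ((2 * b / a * 8 powr \<delta>) powr (1 / (\<delta> - s))) powr (\<delta> - s)"
    using s A by (simp add: powr_powr)
  also have "\<dots> \<le> R powr (\<delta> - s)" by (intro powr_mono2) (use s in \<open>auto simp: R_def\<close>)
  finally have Rs: "2 * b / a * 8 powr \<delta> * R powr s \<le> R powr \<delta>"
    using R4 by (simp add: powr_diff pos_le_divide_eq)
  define \<rho> where "\<rho> k = r0 / R ^ k" for k
  have \<rho>: "\<rho> k > 0" "\<rho> k \<le> r0" "\<rho> (Suc k) = \<rho> k / R" for k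
    using r0 R4 one_le_power[of R k] by (auto simp: \<rho>_def divide_le_eq mult_le_cancel_left1)
  \<comment> \<open>The distance bound holds on the whole child ball, so it applies to the limit
    point of the branch.\<close>
  define G where "G k x y \<longleftrightarrow> (\<forall>q\<in>rational_points. real_of_int (height q) powr \<theta> * \<rho> k \<le> c0 \<longrightarrow>
      (\<forall>z\<in>cball y (\<rho> (Suc k)). \<gamma> * \<rho> k \<le> dist z q))" for k and x y :: "'n proj"
  show ?thesis
  proof (rule tree_hausdorff_measure_nonzero[OF \<Omega>(2,1) s(1), of R r0 G])
    show "R > 1" "r0 > 0" using R4 r0 by auto
    fix k and x :: "'n proj" assume x: "x \<in> \<Omega>"
    define r where "r = \<rho> k"
    have r: "r > 0" "r \<le> r0" by (simp_all add: r_def \<rho>)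
    have e: "0 < 4 * (r / R)" "4 * (r / R) \<le> r1" "r / R \<le> r / 4" "r / R \<le> \<gamma> * r"
    proof -
      show *: "r / R \<le> r / 4" using r R4 by (intro divide_left_mono) auto
      show "0 < 4 * (r / R)" using r R4 by simp
      show "4 * (r / R) \<le> r1" using * r r0 by linarith
      show "r / R \<le> \<gamma> * r" using mult_right_mono[OF R\<gamma>, of r] r by simp
    qed
    obtain P where P: "proj_hyperplane N P"
      "\<And>q. q \<in> rational_points \<Longrightarrow> dist x q \<le> 2 * r \<Longrightarrow> real_of_int (height q) powr \<theta> * r \<le> c0 \<Longrightarrow> q \<in> P"
      using c0(2)[OF r(1), of x] by metis
    \<comment> \<open>Centres are sought only within \<open>r / 2\<close> of \<open>x\<close>, so
      that child balls of radius at most \<open>r / 4\<close> stay inside the parent.\<close>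
    have hf: "measure m (cball x (r / 2) \<inter> thickening P (\<beta> * (r / 2))) \<le> measure m (cball x (r / 2)) / 2"
      by (rule half[OF P(1) x]) (use r r0 in auto)
    obtain F where F: "finite F" "F \<subseteq> \<Omega>"
      and Fx: "\<And>y. y \<in> F \<Longrightarrow> dist x y \<le> r / 2 \<and> y \<notin> thickening P (\<beta> * (r / 2))"
      and Fsep: "\<And>y z. y \<in> F \<Longrightarrow> z \<in> F \<Longrightarrow> y \<noteq> z \<Longrightarrow> dist y z > 4 * (r / R)"
      and Fcard: "measure m (cball x (r / 2)) / 2 \<le> card F * (b * (4 * (r / R)) powr \<delta>)"
      using many_separated_points_avoiding[OF m(1,2) \<Omega>(2) m(3) open_thickening hf e(1) upper[OF _ e(1,2)]]
      by metis
    have card: "R powr s \<le> real (card F)"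
    proof -
      have "a * (r / 2) powr \<delta> / 2 \<le> card F * (b * (4 * (r / R)) powr \<delta>)"
        using lower[OF x, of "r / 2"] r r0 Fcard by simp
      moreover have "(4 * (r / R)) powr \<delta> = (r / 2) powr \<delta> * 8 powr \<delta> / R powr \<delta>"
        using r R4 by (simp flip: powr_mult powr_divide)
      ultimately have "(r / 2) powr \<delta> * (a / 2) \<le> (r / 2) powr \<delta> * (card F * b * 8 powr \<delta> / R powr \<delta>)"
        by (simp add: mult_ac)
      then have "a / 2 \<le> card F * b * 8 powr \<delta> / R powr \<delta>"
        using r by (subst (asm) mult_le_cancel_left_pos) auto
      then have "a / 2 * R powr \<delta> \<le> card F * b * 8 powr \<delta>" using R4 by (simp add: pos_le_divide_eq)
      moreover have "a / 2 * (2 * b / a * 8 powr \<delta> * R powr s) \<le> a / 2 * R powr \<delta>"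
        by (rule mult_left_mono[OF Rs]) (use A in simp)
      moreover have "a / 2 * (2 * b / a * 8 powr \<delta> * R powr s) = (b * 8 powr \<delta>) * R powr s"
        using A by simp
      moreover have "card F * b * 8 powr \<delta> = (b * 8 powr \<delta>) * card F" by simp
      ultimately have "(b * 8 powr \<delta>) * R powr s \<le> (b * 8 powr \<delta>) * card F" by linarith
      then show ?thesis using A by (subst (asm) mult_le_cancel_left_pos) auto
    qed
    have sub: "cball y (r / R) \<subseteq> cball x r" if "y \<in> F" for y
    proof
      fix z assume "z \<in> cball y (r / R)"
      then have "dist y z \<le> r / R" by simp
      moreover have "dist x y \<le> r / 2" using Fx[OF that] by blast
      ultimately have "dist x z \<le> r" using e(3) dist_triangle[of x z y] r by linarith
      then show "z \<in> cball x r" by simp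
    qed
    \<comment> \<open>Rational points within \<open>2 * r\<close> of \<open>x\<close> lie in
      \<open>P\<close>, which the child centres avoid; the others are farther than \<open>r\<close>
      from the parent ball, and \<open>\<gamma>\<close> is at most 1.\<close>
    have avoid: "\<gamma> * r \<le> dist z q"
      if y: "y \<in> F" and q: "q \<in> rational_points" "real_of_int (height q) powr \<theta> * r \<le> c0"
        and z: "z \<in> cball y (r / R)" for y z q
    proof (cases "dist x q \<le> 2 * r")
      case True
      then have "2 * \<gamma> * r \<le> dist y q"
        using dist_ge_if_not_in_thickening[of y P "\<beta> * (r / 2)" q] Fx[OF y] P(2) q by (simp add: \<gamma>_def)
      moreover have "dist y q \<le> dist y z + dist z q" by (rule dist_triangle)
      moreover have "dist y z \<le> r / R" using z by simp
      ultimately show ?thesis using e(4) by linarith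
    next
      case False
      have "dist x z \<le> r" using sub[OF y] z by auto
      moreover have "\<gamma> * r \<le> r" using B r by (simp add: \<gamma>_def)
      ultimately show ?thesis using dist_triangle[of x q z] False by simp
    qed
    show "\<exists>F. finite F \<and> F \<subseteq> \<Omega> \<and> R powr s \<le> real (card F) \<and>
      (\<forall>y\<in>F. cball y (r0 / R ^ Suc k) \<subseteq> cball x (r0 / R ^ k) \<and> G k x y) \<and>
      (\<forall>y\<in>F. \<forall>y'\<in>F. y \<noteq> y' \<longrightarrow> 3 * (r0 / R ^ Suc k) < dist y y')"
    proof (intro exI[of _ F] conjI ballI impI)
      have eq: "r0 / R ^ Suc k = r / R" "r0 / R ^ k = r" using \<rho>(3)[of k] by (simp_all add: r_def \<rho>_def)
      show "G k x y" if "y \<in> F" for y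
        unfolding G_def \<rho>(3) r_def[symmetric] using avoid[OF that] by blast
      show "cball y (r0 / R ^ Suc k) \<subseteq> cball x (r0 / R ^ k)" if "y \<in> F" for y
        unfolding eq by (rule sub[OF that])
      show "3 * (r0 / R ^ Suc k) < dist y y'" if "y \<in> F" "y' \<in> F" "y \<noteq> y'" for y y'
        unfolding eq using Fsep[OF that] e(1) by linarith
    qed (use F card in auto)
  next
    fix X z assume z: "z \<in> \<Omega>" and XG: "\<And>k. G k (X k) (X (Suc k))" and zX: "\<And>k. z \<in> cball (X k) (r0 / R ^ k)"
    have "z \<in> Bad N"
    proof (rule BadI_geometric_scales[OF r0(1) _ \<gamma> c0(1)])
      show "R > 1" using R4 by simp
      fix k and q :: "'n proj"
      assume "q \<in> rational_points" "real_of_int (height q) powr (real (N + 1) / real N) * (r0 / R ^ k) \<le> c0"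
      \<comment> \<open>\<open>G\<close> at level \<open>k\<close> speaks about the child ball, so
        membership in the ball of level \<open>Suc k\<close> is the relevant one.\<close>
      then show "\<gamma> * (r0 / R ^ k) \<le> dist z q"
        using XG[of k] zX[of "Suc k"] unfolding G_def \<theta>_def \<rho>_def by blast
    qed
    then show "z \<in> Bad N \<inter> \<Omega>" using z by blast
  qed
qed

theorem theorem10:
  fixes N :: nat
    and \<Omega> :: "'n::finite proj set"
    and m :: "'n proj measure"
    and \<delta> \<eta> :: real
  assumes "N \<ge> 1" and "CARD('n) = N + 1"
    and "\<Omega> \<noteq> {}" and "compact \<Omega>"
    and "locally_finite_borel m" and "supported_on m \<Omega>"
    and "\<delta> > 0" and "\<eta> > 0"
    and "ahlfors_regular \<delta> \<Omega> m"
    and "proj_abs_decaying N \<eta> \<Omega> m"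
  shows "hausdorff_dim (Bad N \<inter> \<Omega>) = hausdorff_dim \<Omega> \<and> hausdorff_dim \<Omega> = ennreal \<delta>"
proof -
  have fin: "finite_measure m" by (rule finite_measure_of_compact_support[OF assms(4,5,6)])
  have sets: "sets m = sets borel" using assms(5) by (simp add: locally_finite_borel_def)
  have "ennreal \<delta> \<le> hausdorff_dim (Bad N \<inter> \<Omega>)"
    unfolding hausdorff_dim_def
  proof (rule Inf_greatest)
    fix t assume "t \<in> {ennreal s |s. 0 < s \<and> hausdorff_measure s (Bad N \<inter> \<Omega>) = 0}"
    then obtain s where s: "t = ennreal s" "0 < s" "hausdorff_measure s (Bad N \<inter> \<Omega>) = 0" by blast
    \<comment> \<open>No exponent below \<open>\<delta>\<close> has measure zero, so
      \<open>\<delta>\<close> bounds from below the set whose infimum is the dimension.\<close>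
    have "\<not> s < \<delta>"
      using hausdorff_measure_Bad_nonzero[OF assms(1-4) fin sets assms(6,8-10) s(2)] s(3) by blast
    then show "ennreal \<delta> \<le> t" using s(1) by (simp add: ennreal_leI)
  qed
  moreover have "hausdorff_dim (Bad N \<inter> \<Omega>) \<le> hausdorff_dim \<Omega>" by (rule hausdorff_dim_mono) simp
  moreover have "hausdorff_dim \<Omega> \<le> ennreal \<delta>"
  proof (rule ennreal_le_epsilon)
    fix e :: real assume e: "0 < e"
    obtain r0 a b where A: "r0 > 0" "a > 0"
      "\<And>x r. x \<in> \<Omega> \<Longrightarrow> 0 < r \<Longrightarrow> r \<le> r0 \<Longrightarrow> a * r powr \<delta> \<le> measure m (cball x r)"
      using ahlfors_regular_measure[OF fin assms(9)] by metis
    have "hausdorff_measure (\<delta> + e) \<Omega> = 0"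
      by (rule hausdorff_measure_eq_0_of_lower_regular[OF fin sets assms(4) A(2,1,3)]) (use e assms(7) in auto)
    then have "hausdorff_dim \<Omega> \<le> ennreal (\<delta> + e)"
      unfolding hausdorff_dim_def using e assms(7) by (intro Inf_lower CollectI exI[of _ "\<delta> + e"]) simp
    then show "hausdorff_dim \<Omega> \<le> ennreal \<delta> + ennreal e" using e assms(7) by (simp add: ennreal_plus)
  qed
  ultimately show ?thesis by (meson antisym order_trans)
qed

end
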